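(* Let $B$ be a finite bipartite graph and $A(B)$ its bipartite algebra. Each simple graded left $A(B)$-module $L_i$ ($i\in V(B)$) has a finite linear projective resolution.
   Context: Let $B$ have vertex bipartition $V(B)=V_0(B)\sqcup V_1(B)$. Let $Q(B)$ be the double quiver of $B$ (each edge replaced by two arrows, one in each orientation). The bipartite algebra $A(B)$ is the quotient of the path algebra of $Q(B)$ over $\mathbb C$ (product = concatenation, first path then second) by the ideal generated by all length-two paths which start and end in $V_0(B)$; it is $\mathbb Z$-graded by path length. Let $e_i$ be the constant path at $i$, and $P_i=A(B)e_i$ (spanned by paths ending at $i$), graded by path length. $L_i$ is the one-dimensional module in degree $0$ on which $e_i$ acts as the identity and all $e_j$, $j\neq i$, and all elements of positive degree act by zero. The grading shift is $M\{k\}_m=M_{m-k}$. A linear projective resolution of $L_i$ is a resolution by graded modules with degree-preserving maps whose $k$-th term is a finite direct sum of modules of the form $P_j\{k\}$, i.e. a projective module generated in degree $k$. *)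

theory Defs
  imports Complex_Main "Graph_Theory.Arc_Walk" "HOL-Algebra.QuotRing" "HOL-Algebra.Module"
begin

section \<open>Bipartite graphs and their double quivers\<close>

text \<open>
  Edges are elements of a set of their own, so multiple edges are allowed; a simple bipartite
  graph is the case where an edge is determined by its two ends.  Since every edge joins a vertex
  of \<open>part0\<close> to a vertex of \<open>part1\<close>, it has a well-defined end in each part.
\<close>
record ('v, 'e) bipartite_graph =
  part0 :: "'v set"
  part1 :: "'v set"
  edges :: "'e set"
  end0 :: "'e \<Rightarrow> 'v"
  end1 :: "'e \<Rightarrow> 'v"

definition vertices :: "('v, 'e) bipartite_graph \<Rightarrow> 'v set" where
  "vertices B = part0 B \<union> part1 B"

definition finite_bipartite_graph :: "('v, 'e) bipartite_graph \<Rightarrow> bool" where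
  "finite_bipartite_graph B \<longleftrightarrow>
     finite (part0 B) \<and> finite (part1 B) \<and> part0 B \<inter> part1 B = {} \<and> finite (edges B) \<and>
     (\<forall>e\<in>edges B. end0 B e \<in> part0 B \<and> end1 B e \<in> part1 B)"

text \<open>
  The arrow \<open>(e, True)\<close> is the edge \<open>e\<close> oriented from \<open>part0\<close> to \<open>part1\<close>, and \<open>(e, False)\<close> is the
  same edge with the opposite orientation.
\<close>
definition double_quiver :: "('v, 'e) bipartite_graph \<Rightarrow> ('v, 'e \<times> bool) pre_digraph" where
  "double_quiver B =
     \<lparr>verts = vertices B,
      arcs = edges B \<times> UNIV,
      tail = (\<lambda>(e, b). if b then end0 B e else end1 B e),
      head = (\<lambda>(e, b). if b then end1 B e else end0 B e)\<rparr>"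


section \<open>Path algebras\<close>

text \<open>A path is given by its starting vertex and its list of arrows; this covers constant paths.\<close>

type_synonym ('v, 'a) path = "'v \<times> 'a list"

definition path_start :: "('v, 'a) path \<Rightarrow> 'v" where
  "path_start x = fst x"

definition path_end :: "('v, 'a) pre_digraph \<Rightarrow> ('v, 'a) path \<Rightarrow> 'v" where
  "path_end Q x = pre_digraph.awlast Q (fst x) (snd x)"

definition path_length :: "('v, 'a) path \<Rightarrow> nat" where
  "path_length x = length (snd x)"

definition paths :: "('v, 'a) pre_digraph \<Rightarrow> ('v, 'a) path set" where
  "paths Q = {x. pre_digraph.awalk Q (path_start x) (snd x) (path_end Q x)}"

text \<open>
  Elements of the complex path algebra are the finitely supported functions on paths.  The product
  of two paths is their concatenation, the first factor being travelled first, and \<open>0\<close> if they do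
  not match; hence the coefficient of a product at a path is a sum over the ways of cutting that
  path into two.
\<close>
definition path_algebra ::
  "('v, 'a) pre_digraph \<Rightarrow> (('v, 'a) path \<Rightarrow> complex) ring" where
  "path_algebra Q =
     \<lparr>carrier = {f. finite {x. f x \<noteq> 0} \<and> {x. f x \<noteq> 0} \<subseteq> paths Q},
      mult = (\<lambda>f g (u, p). \<Sum>k\<le>length p.
                f (u, take k p) * g (path_end Q (u, take k p), drop k p)),
      one = (\<lambda>(u, p). if u \<in> verts Q \<and> p = [] then 1 else 0),
      zero = (\<lambda>_. 0),
      add = (\<lambda>f g x. f x + g x)\<rparr>"

definition path_vector :: "('v, 'a) path \<Rightarrow> ('v, 'a) path \<Rightarrow> complex" where
  "path_vector x = (\<lambda>y. if y = x then 1 else 0)"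

definition path_algebra_component ::
  "('v, 'a) pre_digraph \<Rightarrow> int \<Rightarrow> (('v, 'a) path \<Rightarrow> complex) set" where
  "path_algebra_component Q m =
     {f \<in> carrier (path_algebra Q). \<forall>x. f x \<noteq> 0 \<longrightarrow> int (path_length x) = m}"


section \<open>Bipartite algebras\<close>

definition bipartite_ideal ::
  "('v, 'e) bipartite_graph \<Rightarrow> (('v, 'e \<times> bool) path \<Rightarrow> complex) set" where
  "bipartite_ideal B =
     Idl\<^bsub>path_algebra (double_quiver B)\<^esub>
       {path_vector x | x. x \<in> paths (double_quiver B) \<and> path_length x = 2 \<and>
          path_start x \<in> part0 B \<and> path_end (double_quiver B) x \<in> part0 B}"

type_synonym ('v, 'e) bip = "(('v, 'e \<times> bool) path \<Rightarrow> complex) set"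

text \<open>
  The action of \<open>\<complex>\<close> on this algebra, and on its modules, is the one through the scalar multiples
  of the unit, so only the ring structure is recorded.
\<close>
definition bipartite_algebra :: "('v, 'e) bipartite_graph \<Rightarrow> ('v, 'e) bip ring" where
  "bipartite_algebra B = path_algebra (double_quiver B) Quot bipartite_ideal B"

definition bip_class ::
  "('v, 'e) bipartite_graph \<Rightarrow> (('v, 'e \<times> bool) path \<Rightarrow> complex) \<Rightarrow> ('v, 'e) bip" where
  "bip_class B f = bipartite_ideal B +>\<^bsub>path_algebra (double_quiver B)\<^esub> f"

definition bip_component :: "('v, 'e) bipartite_graph \<Rightarrow> int \<Rightarrow> ('v, 'e) bip set" where
  "bip_component B m = bip_class B ` path_algebra_component (double_quiver B) m"

definition bip_idem :: "('v, 'e) bipartite_graph \<Rightarrow> 'v \<Rightarrow> ('v, 'e) bip" where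
  "bip_idem B i = bip_class B (path_vector (i, []))"


section \<open>Graded left modules\<close>

text \<open>The locale of HOL-Algebra for modules requires a commutative ring.\<close>

locale left_module = R?: ring R + M?: abelian_group M for R (structure) and M (structure) +
  assumes smult_closed:
      "\<lbrakk>a \<in> carrier R; x \<in> carrier M\<rbrakk> \<Longrightarrow> a \<odot>\<^bsub>M\<^esub> x \<in> carrier M"
    and smult_l_distr:
      "\<lbrakk>a \<in> carrier R; b \<in> carrier R; x \<in> carrier M\<rbrakk> \<Longrightarrow>
       (a \<oplus>\<^bsub>R\<^esub> b) \<odot>\<^bsub>M\<^esub> x = a \<odot>\<^bsub>M\<^esub> x \<oplus>\<^bsub>M\<^esub> b \<odot>\<^bsub>M\<^esub> x"
    and smult_r_distr:
      "\<lbrakk>a \<in> carrier R; x \<in> carrier M; y \<in> carrier M\<rbrakk> \<Longrightarrow>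
       a \<odot>\<^bsub>M\<^esub> (x \<oplus>\<^bsub>M\<^esub> y) = a \<odot>\<^bsub>M\<^esub> x \<oplus>\<^bsub>M\<^esub> a \<odot>\<^bsub>M\<^esub> y"
    and smult_assoc1:
      "\<lbrakk>a \<in> carrier R; b \<in> carrier R; x \<in> carrier M\<rbrakk> \<Longrightarrow>
       (a \<otimes>\<^bsub>R\<^esub> b) \<odot>\<^bsub>M\<^esub> x = a \<odot>\<^bsub>M\<^esub> (b \<odot>\<^bsub>M\<^esub> x)"
    and smult_one:
      "x \<in> carrier M \<Longrightarrow> \<one>\<^bsub>R\<^esub> \<odot>\<^bsub>M\<^esub> x = x"

record ('a, 'm) graded_module = "('a, 'm) module" +
  component :: "int \<Rightarrow> 'm set"

definition internal_direct_sum :: "('m, 'z) ring_scheme \<Rightarrow> (int \<Rightarrow> 'm set) \<Rightarrow> bool" where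
  "internal_direct_sum M D \<longleftrightarrow>
     (\<forall>m. additive_subgroup (D m) M) \<and>
     (\<forall>x\<in>carrier M. \<exists>!f. (\<forall>m. f m \<in> D m) \<and> finite {m. f m \<noteq> \<zero>\<^bsub>M\<^esub>} \<and>
        x = (\<Oplus>\<^bsub>M\<^esub>m\<in>{m. f m \<noteq> \<zero>\<^bsub>M\<^esub>}. f m))"

definition graded_ring :: "'a ring \<Rightarrow> (int \<Rightarrow> 'a set) \<Rightarrow> bool" where
  "graded_ring R D \<longleftrightarrow>
     ring R \<and> internal_direct_sum R D \<and>
     (\<forall>k m. \<forall>a\<in>D k. \<forall>b\<in>D m. a \<otimes>\<^bsub>R\<^esub> b \<in> D (k + m))"

definition graded_left_module ::
  "'a ring \<Rightarrow> (int \<Rightarrow> 'a set) \<Rightarrow> ('a, 'm) graded_module \<Rightarrow> bool" where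
  "graded_left_module R D M \<longleftrightarrow>
     graded_ring R D \<and> left_module R M \<and> internal_direct_sum M (component M) \<and>
     (\<forall>k m. \<forall>a\<in>D k. \<forall>x\<in>component M m. a \<odot>\<^bsub>M\<^esub> x \<in> component M (k + m))"

definition graded_hom ::
  "'a ring \<Rightarrow> ('a, 'm) graded_module \<Rightarrow> ('a, 'n) graded_module \<Rightarrow> ('m \<Rightarrow> 'n) set" where
  "graded_hom R M N = {h.
     (\<forall>x\<in>carrier M. h x \<in> carrier N) \<and>
     (\<forall>x\<in>carrier M. \<forall>y\<in>carrier M. h (x \<oplus>\<^bsub>M\<^esub> y) = h x \<oplus>\<^bsub>N\<^esub> h y) \<and>
     (\<forall>a\<in>carrier R. \<forall>x\<in>carrier M. h (a \<odot>\<^bsub>M\<^esub> x) = a \<odot>\<^bsub>N\<^esub> h x) \<and>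
     (\<forall>m. \<forall>x\<in>component M m. h x \<in> component N m)}"

definition grading_shift :: "int \<Rightarrow> ('a, 'm) graded_module \<Rightarrow> ('a, 'm) graded_module" where
  "grading_shift k M = M\<lparr>component := (\<lambda>m. component M (m - k))\<rparr>"

text \<open>
  External direct sum of finitely many graded modules, with tuples as extensional functions; the
  empty sum is the zero module.  The ring fields \<open>mult\<close> and \<open>one\<close> of a module record carry no
  meaning.
\<close>
definition graded_direct_sum ::
  "('a, 'm) graded_module list \<Rightarrow> ('a, nat \<Rightarrow> 'm) graded_module" where
  "graded_direct_sum Ms =
     \<lparr>carrier = (\<Pi>\<^sub>E r\<in>{..<length Ms}. carrier (Ms ! r)),
      mult = undefined,
      one = undefined,
      zero = (\<lambda>r\<in>{..<length Ms}. \<zero>\<^bsub>Ms ! r\<^esub>),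
      add = (\<lambda>x y. \<lambda>r\<in>{..<length Ms}. x r \<oplus>\<^bsub>Ms ! r\<^esub> y r),
      smult = (\<lambda>a x. \<lambda>r\<in>{..<length Ms}. a \<odot>\<^bsub>Ms ! r\<^esub> x r),
      component = (\<lambda>m. \<Pi>\<^sub>E r\<in>{..<length Ms}. component (Ms ! r) m)\<rparr>"


section \<open>The modules \<open>P\<^sub>i\<close> and \<open>L\<^sub>i\<close>\<close>

definition bip_projective ::
  "('v, 'e) bipartite_graph \<Rightarrow> 'v \<Rightarrow> (('v, 'e) bip, ('v, 'e) bip) graded_module" where
  "bip_projective B i =
     (let A = bipartite_algebra B;
          P = {a \<otimes>\<^bsub>A\<^esub> bip_idem B i | a. a \<in> carrier A}
      in \<lparr>carrier = P,
          mult = undefined,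
          one = undefined,
          zero = \<zero>\<^bsub>A\<^esub>,
          add = (\<lambda>x y. x \<oplus>\<^bsub>A\<^esub> y),
          smult = (\<lambda>a x. a \<otimes>\<^bsub>A\<^esub> x),
          component = (\<lambda>m. P \<inter> bip_component B m)\<rparr>)"

text \<open>
  The ideal only involves paths of length at least \<open>2\<close>, so all representatives of an element
  \<open>a\<close> of the bipartite algebra have the same coefficient at the constant path \<open>(i, [])\<close>.  This
  coefficient is the scalar by which \<open>a\<close> acts on \<open>L\<^sub>i\<close>.
\<close>
definition bip_simple ::
  "('v, 'e) bipartite_graph \<Rightarrow> 'v \<Rightarrow> (('v, 'e) bip, complex) graded_module" where
  "bip_simple B i =
     \<lparr>carrier = UNIV,
      mult = undefined,
      one = undefined,
      zero = 0,
      add = (+),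
      smult = (\<lambda>a z. the_elem ((\<lambda>f. f (i, [])) ` a) * z),
      component = (\<lambda>m. if m = 0 then UNIV else {0})\<rparr>"


section \<open>Linear projective resolutions\<close>

definition linear_projective_resolution ::
  "('v, 'e) bipartite_graph \<Rightarrow> (('v, 'e) bip, 'm) graded_module \<Rightarrow>
   (nat \<Rightarrow> (('v, 'e) bip, nat \<Rightarrow> ('v, 'e) bip) graded_module) \<Rightarrow>
   (nat \<Rightarrow> (nat \<Rightarrow> ('v, 'e) bip) \<Rightarrow> (nat \<Rightarrow> ('v, 'e) bip)) \<Rightarrow>
   ((nat \<Rightarrow> ('v, 'e) bip) \<Rightarrow> 'm) \<Rightarrow> bool" where
  "linear_projective_resolution B N C d \<epsilon> \<longleftrightarrow>
     (let A = bipartite_algebra B in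
        graded_left_module A (bip_component B) N \<and>
        (\<forall>k. graded_left_module A (bip_component B) (C k)) \<and>
        (\<forall>k. \<exists>js. set js \<subseteq> vertices B \<and>
           C k = graded_direct_sum (map (\<lambda>j. grading_shift (int k) (bip_projective B j)) js)) \<and>
        \<epsilon> \<in> graded_hom A (C 0) N \<and>
        (\<forall>k. d k \<in> graded_hom A (C (Suc k)) (C k)) \<and>
        \<epsilon> ` carrier (C 0) = carrier N \<and>
        d 0 ` carrier (C 1) = a_kernel (C 0) N \<epsilon> \<and>
        (\<forall>k. d (Suc k) ` carrier (C (Suc (Suc k))) = a_kernel (C (Suc k)) (C k) (d k)))"

definition finite_complex :: "(nat \<Rightarrow> ('a, 'm) graded_module) \<Rightarrow> bool" where
  "finite_complex C \<longleftrightarrow> (\<exists>n. \<forall>k>n. carrier (C k) = {\<zero>\<^bsub>C k\<^esub>})"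

end

theory Submission
  imports Defs
begin

text \<open>
  The bipartite algebra is a path algebra modulo monomials of length two, and such an algebra is
  Koszul for a combinatorial reason. Call a path \<^emph>\<open>reduced\<close> if no pair of consecutive arrows in it is a
  relation, and a \<^emph>\<open>word\<close> if all such pairs are relations. The reduced paths form a basis of the algebra
  (\<open>quadratic_monomial_ideal\<close>), which turns every claim about elements of the algebra and of its
  projective modules into a claim about coordinates.

  In degree \<open>k\<close> the resolution of the simple module at \<open>i\<close> has one summand \<open>P\<^sub>j{k}\<close> for every word \<open>w\<close>
  of length \<open>k\<close> from \<open>j\<close> to \<open>i\<close>. A basis of this term consists of the pairs of a reduced path and a word
  that starts where the path ends. The differential moves the first arrow of the word to the end of
  the path, so it maps \<open>(p, aw)\<close> to \<open>(pa, w)\<close>, or to \<open>0\<close> if \<open>pa\<close> is not reduced; it keeps the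
  degree, which is the length of the path plus that of the word. It maps different basis elements
  that it does not kill to different basis elements, so exactness can be checked on basis elements.
  Take a pair \<open>(pb, aw)\<close>. If \<open>b\<close> and \<open>a\<close> form a relation,
  then \<open>baw\<close> is a word, and \<open>(pb, aw)\<close> is the image of \<open>(p, baw)\<close> and is mapped to \<open>0\<close>. If they do not,
  then \<open>pba\<close> is reduced, since relations have length two; now \<open>(pb, aw)\<close> is not an image and is not
  mapped to \<open>0\<close>. The pair \<open>(e, aw)\<close> with a constant path \<open>e\<close> is neither an image nor killed. Hence image and
  kernel are cut out by the same condition (\<open>diff_image\<close>, \<open>diff_kernel\<close> and, at the end of the complex,
  \<open>augmentation_kernel\<close>).

  The bipartite structure bounds the length of the complex: a relation passes from \<open>part0\<close> to
  \<open>part1\<close> and back, so relations cannot overlap, and there are no words of length three (\<open>koszul_finite\<close>).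
\<close>

section \<open>Paths and the path algebra\<close>

lemma path_end_conv: "path_end Q (u, p) = (if p = [] then u else head Q (last p))"
  by (auto simp: path_end_def pre_digraph.awalk_verts_conv)

lemma path_end_Nil [simp]: "path_end Q (u, []) = u"
  by (simp add: path_end_conv)

lemma path_end_snoc [simp]: "path_end Q (u, p @ [a]) = head Q a"
  by (simp add: path_end_conv)

lemma path_end_append: "path_end Q (u, p @ q) = path_end Q (path_end Q (u, p), q)"
  by (simp add: path_end_conv)

lemma path_mult:
  "(f \<otimes>\<^bsub>path_algebra Q\<^esub> g) (u, p) =
     (\<Sum>k\<le>length p. f (u, take k p) * g (path_end Q (u, take k p), drop k p))"
  by (simp add: path_algebra_def)

lemma path_add: "(f \<oplus>\<^bsub>path_algebra Q\<^esub> g) x = f x + g x"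
  by (simp add: path_algebra_def)

lemma path_zero: "\<zero>\<^bsub>path_algebra Q\<^esub> x = 0"
  by (simp add: path_algebra_def)

lemma path_carrier_iff:
  "f \<in> carrier (path_algebra Q) \<longleftrightarrow> finite {x. f x \<noteq> 0} \<and> (\<forall>x. f x \<noteq> 0 \<longrightarrow> x \<in> paths Q)"
  by (auto simp: path_algebra_def)

lemma path_mult_nonzeroE:
  assumes "(f \<otimes>\<^bsub>path_algebra Q\<^esub> g) (u, p) \<noteq> 0"
  obtains q r where "p = q @ r" "f (u, q) \<noteq> 0" "g (path_end Q (u, q), r) \<noteq> 0"
proof -
  obtain k where "f (u, take k p) * g (path_end Q (u, take k p), drop k p) \<noteq> 0"
    using assms unfolding path_mult by (meson sum.not_neutral_contains_not_neutral)
  then show thesis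
    using that[of "take k p" "drop k p"] by simp
qed

lemma path_carrier_subset:
  assumes "f \<in> carrier (path_algebra Q)" "\<And>x. g x \<noteq> 0 \<Longrightarrow> f x \<noteq> 0"
  shows "g \<in> carrier (path_algebra Q)"
proof -
  have "{x. g x \<noteq> 0} \<subseteq> {x. f x \<noteq> 0}"
    using assms(2) by auto
  then show ?thesis
    using assms finite_subset unfolding path_carrier_iff by blast
qed

lemma path_vector_scaled_closed:
  "x \<in> paths Q \<Longrightarrow> (\<lambda>y. c * path_vector x y) \<in> carrier (path_algebra Q)"
  by (auto simp: path_carrier_iff path_vector_def)

lemma path_vector_closed: "x \<in> paths Q \<Longrightarrow> path_vector x \<in> carrier (path_algebra Q)"
  using path_vector_scaled_closed[of x Q 1] by simp

lemma mult_path_vector: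
  assumes "length r = length q"
  shows "(f \<otimes>\<^bsub>path_algebra Q\<^esub> path_vector (v, q)) (u, p @ r) =
    (if r = q \<and> path_end Q (u, p) = v then f (u, p) else 0)"
proof -
  have "(f \<otimes>\<^bsub>path_algebra Q\<^esub> path_vector (v, q)) (u, p @ r) =
      (\<Sum>k\<le>length (p @ r). if k = length p then
         (if r = q \<and> path_end Q (u, p) = v then f (u, p) else 0) else 0)"
    unfolding path_mult
  proof (intro sum.cong refl)
    fix k
    assume k: "k \<in> {..length (p @ r)}"
    show "f (u, take k (p @ r)) * path_vector (v, q) (path_end Q (u, take k (p @ r)), drop k (p @ r)) =
        (if k = length p then (if r = q \<and> path_end Q (u, p) = v then f (u, p) else 0) else 0)"
    proof (cases "k = length p")
      case False
      then have "length (drop k (p @ r)) \<noteq> length q"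
        using k assms by auto
      then have "drop k (p @ r) \<noteq> q"
        by metis
      then show ?thesis
        using False by (simp add: path_vector_def)
    qed (auto simp: path_vector_def)
  qed
  then show ?thesis
    by simp
qed

lemma mult_path_vector_short:
  assumes "length p < length q"
  shows "(f \<otimes>\<^bsub>path_algebra Q\<^esub> path_vector (v, q)) (u, p) = 0"
proof -
  have "drop k p \<noteq> q" for k
    using assms by auto
  then show ?thesis
    by (auto simp: path_mult path_vector_def)
qed

lemma path_vector_mult:
  fixes Q :: "('v, 'a) pre_digraph"
  assumes "path_end Q (u, p) = v"
  shows "path_vector (u, p) \<otimes>\<^bsub>path_algebra Q\<^esub> path_vector (v, q) = path_vector (u, p @ q)"
proof
  fix x :: "'v \<times> 'a list"
  obtain w s where x: "x = (w, s)"
    by fastforce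
  show "(path_vector (u, p) \<otimes>\<^bsub>path_algebra Q\<^esub> path_vector (v, q)) x = path_vector (u, p @ q) x"
  proof (cases "length s < length q")
    case True
    then have "(w, s) \<noteq> (u, p @ q)"
      by auto
    then show ?thesis
      using mult_path_vector_short[OF True, of Q "path_vector (u, p)" v w]
      by (simp add: x path_vector_def)
  next
    case False
    then obtain t r where "s = t @ r" "length r = length q"
      by (metis append_take_drop_id diff_diff_cancel length_drop not_less)
    then show ?thesis
      using assms by (simp add: x mult_path_vector) (auto simp: path_vector_def)
  qed
qed

context wf_digraph
begin

lemma paths_Nil: "(u, []) \<in> paths G \<longleftrightarrow> u \<in> verts G"
  by (auto simp: paths_def path_start_def awalk_def)

lemma path_end_Cons: "path_end G (u, a # p) = path_end G (head G a, p)"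
  by (simp add: path_end_conv)

lemma paths_Cons:
  "(u, a # p) \<in> paths G \<longleftrightarrow> a \<in> arcs G \<and> u = tail G a \<and> (head G a, p) \<in> paths G"
  by (auto simp: paths_def path_start_def awalk_Cons_iff path_end_Cons)

lemma paths_append:
  "(u, p @ q) \<in> paths G \<longleftrightarrow> (u, p) \<in> paths G \<and> (path_end G (u, p), q) \<in> paths G"
proof (induction p arbitrary: u)
  case Nil
  then show ?case
    by (cases q) (auto simp: paths_Nil paths_Cons)
qed (auto simp: paths_Cons path_end_Cons)

lemma path_end_in_verts: "(u, p) \<in> paths G \<Longrightarrow> path_end G (u, p) \<in> verts G"
  using paths_append[of u p "[]"] by (simp add: paths_Nil)

lemma path_mult_closed:
  assumes "f \<in> carrier (path_algebra G)" "g \<in> carrier (path_algebra G)"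
  shows "f \<otimes>\<^bsub>path_algebra G\<^esub> g \<in> carrier (path_algebra G)"
proof -
  let ?h = "f \<otimes>\<^bsub>path_algebra G\<^esub> g"
  have "{x. ?h x \<noteq> 0} \<subseteq> (\<lambda>(x, y). (fst x, snd x @ snd y)) ` ({x. f x \<noteq> 0} \<times> {x. g x \<noteq> 0})"
  proof clarify
    fix u p
    assume "?h (u, p) \<noteq> 0"
    then obtain q r where "p = q @ r" "f (u, q) \<noteq> 0" "g (path_end G (u, q), r) \<noteq> 0"
      by (rule path_mult_nonzeroE)
    then show "(u, p) \<in> (\<lambda>(x, y). (fst x, snd x @ snd y)) ` ({x. f x \<noteq> 0} \<times> {x. g x \<noteq> 0})"
      by (intro image_eqI[where x = "((u, q), (path_end G (u, q), r))"]) auto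
  qed
  then have "finite {x. ?h x \<noteq> 0}"
    using assms by (auto simp: path_carrier_iff intro: finite_subset)
  moreover have "(u, p) \<in> paths G" if h: "?h (u, p) \<noteq> 0" for u p
    using path_mult_nonzeroE[OF h] assms paths_append path_carrier_iff by metis
  ultimately show ?thesis
    by (auto simp: path_carrier_iff)
qed

text \<open>
  Both bracketings count the ways of cutting a path into three: by the later cut and the earlier
  one on the left, and by the earlier cut and the length of the middle piece on the right.
\<close>
lemma path_mult_assoc:
  "(f \<otimes>\<^bsub>path_algebra G\<^esub> g) \<otimes>\<^bsub>path_algebra G\<^esub> h = f \<otimes>\<^bsub>path_algebra G\<^esub> (g \<otimes>\<^bsub>path_algebra G\<^esub> h)"
proof
  fix x :: "'a \<times> 'b list"
  obtain u p where x: "x = (u, p)"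
    by fastforce
  define F where "F = (\<lambda>l j. f (u, take l p) * (g (path_end G (u, take l p), take j (drop l p)) *
      h (path_end G (u, take (l + j) p), drop (l + j) p)))"
  have "((f \<otimes>\<^bsub>path_algebra G\<^esub> g) \<otimes>\<^bsub>path_algebra G\<^esub> h) x = (\<Sum>k\<le>length p. \<Sum>l\<le>k. F l (k - l))"
    unfolding x path_mult sum_distrib_right F_def
    by (intro sum.cong refl) (simp_all add: min_def drop_take mult.assoc)
  also have "\<dots> = (\<Sum>(l, j)\<in>{(l, j). l + j \<le> length p}. F l j)"
    by (rule sum.triangle_reindex_eq[symmetric])
  also have "{(l, j). l + j \<le> length p} = (SIGMA l:{..length p}. {..length p - l})"
    by auto
  also have "(\<Sum>(l, j)\<in>(SIGMA l:{..length p}. {..length p - l}). F l j) =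
      (\<Sum>l\<le>length p. \<Sum>j\<le>length p - l. F l j)"
    by (simp add: sum.Sigma)
  also have "\<dots> = (f \<otimes>\<^bsub>path_algebra G\<^esub> (g \<otimes>\<^bsub>path_algebra G\<^esub> h)) x"
    unfolding x path_mult sum_distrib_left F_def
    by (intro sum.cong refl)
      (simp_all add: path_end_append[symmetric] take_add[symmetric] add.commute)
  finally show "((f \<otimes>\<^bsub>path_algebra G\<^esub> g) \<otimes>\<^bsub>path_algebra G\<^esub> h) x =
      (f \<otimes>\<^bsub>path_algebra G\<^esub> (g \<otimes>\<^bsub>path_algebra G\<^esub> h)) x" .
qed

lemma path_one_mult:
  assumes "f \<in> carrier (path_algebra G)"
  shows "\<one>\<^bsub>path_algebra G\<^esub> \<otimes>\<^bsub>path_algebra G\<^esub> f = f"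
proof
  fix x :: "'a \<times> 'b list"
  obtain u p where x: "x = (u, p)"
    by fastforce
  have "(\<one>\<^bsub>path_algebra G\<^esub> \<otimes>\<^bsub>path_algebra G\<^esub> f) x =
      (\<Sum>k\<le>length p. if k = 0 then (if u \<in> verts G then f x else 0) else 0)"
    unfolding x path_mult by (intro sum.cong) (auto simp: path_algebra_def)
  also have "\<dots> = f x"
    using assms paths_append[of u "[]" p] by (auto simp: x path_carrier_iff paths_Nil)
  finally show "(\<one>\<^bsub>path_algebra G\<^esub> \<otimes>\<^bsub>path_algebra G\<^esub> f) x = f x" .
qed

lemma path_mult_one:
  assumes "f \<in> carrier (path_algebra G)"
  shows "f \<otimes>\<^bsub>path_algebra G\<^esub> \<one>\<^bsub>path_algebra G\<^esub> = f"
proof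
  fix x :: "'a \<times> 'b list"
  obtain u p where x: "x = (u, p)"
    by fastforce
  have "(f \<otimes>\<^bsub>path_algebra G\<^esub> \<one>\<^bsub>path_algebra G\<^esub>) x =
      (\<Sum>k\<le>length p. if k = length p then (if path_end G x \<in> verts G then f x else 0) else 0)"
    unfolding x path_mult by (intro sum.cong) (auto simp: path_algebra_def)
  also have "\<dots> = f x"
    using assms path_end_in_verts[of u p] by (auto simp: x path_carrier_iff)
  finally show "(f \<otimes>\<^bsub>path_algebra G\<^esub> \<one>\<^bsub>path_algebra G\<^esub>) x = f x" .
qed

lemma path_algebra_ring:
  assumes "finite (verts G)"
  shows "ring (path_algebra G)"
proof (rule ringI)
  show "abelian_group (path_algebra G)"
  proof (rule abelian_groupI)
    fix f g
    assume "f \<in> carrier (path_algebra G)" "g \<in> carrier (path_algebra G)"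
    moreover from this have "finite {x. f x + g x \<noteq> 0}"
      by (intro finite_subset[of "{x. f x + g x \<noteq> 0}" "{x. f x \<noteq> 0} \<union> {x. g x \<noteq> 0}"])
        (auto simp: path_carrier_iff)
    ultimately show "f \<oplus>\<^bsub>path_algebra G\<^esub> g \<in> carrier (path_algebra G)"
      unfolding path_carrier_iff path_add by (metis add.right_neutral)
  next
    fix f
    assume "f \<in> carrier (path_algebra G)"
    then show "\<exists>g\<in>carrier (path_algebra G). g \<oplus>\<^bsub>path_algebra G\<^esub> f = \<zero>\<^bsub>path_algebra G\<^esub>"
      by (intro bexI[where x = "\<lambda>x. - f x"]) (auto simp: path_algebra_def)
  qed (auto simp: path_algebra_def)
  show "monoid (path_algebra G)"
  proof (rule monoidI)
    have "{x. \<one>\<^bsub>path_algebra G\<^esub> x \<noteq> 0} = (\<lambda>u. (u, [])) ` verts G"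
      by (auto simp: path_algebra_def split: if_splits)
    then show "\<one>\<^bsub>path_algebra G\<^esub> \<in> carrier (path_algebra G)"
      using assms by (auto simp: path_algebra_def paths_Nil split: if_splits)
  qed (auto simp: path_mult_closed path_mult_assoc path_one_mult path_mult_one)
qed (auto simp: path_algebra_def sum.distrib algebra_simps fun_eq_iff)

end

section \<open>Quotients by quadratic monomial relations\<close>

definition reduced :: "('a \<Rightarrow> 'a \<Rightarrow> bool) \<Rightarrow> ('v, 'a) path \<Rightarrow> bool" where
  "reduced R x \<longleftrightarrow> successively (\<lambda>a b. \<not> R a b) (snd x)"

lemma reduced_short [simp]: "reduced R (u, [])" "reduced R (u, [a])"
  by (auto simp: reduced_def)

lemma reduced_appendD:
  assumes "reduced R (u, p @ q)"
  shows "reduced R (u, p)" "reduced R (v, q)"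
  using assms by (auto simp: reduced_def successively_append_iff)

lemma reduced_snoc2:
  "reduced R (u, p @ [b, a]) \<longleftrightarrow> reduced R (u, p @ [b]) \<and> \<not> R b a"
  by (auto simp: reduced_def successively_append_iff)

lemma not_reducedE:
  assumes "\<not> reduced R (u, p)"
  obtains l a b r where "p = l @ [a, b] @ r" "R a b"
proof -
  have "\<exists>l a b r. p = l @ [a, b] @ r \<and> R a b"
    using assms
  proof (induction p arbitrary: u)
    case (Cons a p)
    show ?case
    proof (cases "reduced R (u, p)")
      case True
      with Cons.prems obtain b q where "p = b # q" "R a b"
        by (cases p) (auto simp: reduced_def)
      then show ?thesis
        by (intro exI[where x = "[]"]) auto
    next
      case False
      then obtain l x y r where "p = l @ [x, y] @ r" "R x y"
        using Cons.IH by blast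
      then show ?thesis
        by (intro exI[where x = "a # l"]) auto
    qed
  qed (simp add: reduced_def)
  then show thesis
    using that by blast
qed

lemma path_vector_scaled_mult:
  "(\<lambda>y. c * f y) \<otimes>\<^bsub>path_algebra Q\<^esub> g = (\<lambda>y. c * (f \<otimes>\<^bsub>path_algebra Q\<^esub> g) y)"
  by (auto simp: path_algebra_def sum_distrib_left mult.assoc fun_eq_iff)

text \<open>
  A relation-free path stays relation-free when it is cut, so the functions that vanish on all
  reduced paths form an ideal; conversely a path that is not reduced has a relation as a factor,
  hence lies in every ideal that contains the relations.
\<close>
theorem quadratic_monomial_ideal:
  assumes "fin_digraph Q"
  shows "Idl\<^bsub>path_algebra Q\<^esub> {path_vector (u, [a, b]) | u a b. (u, [a, b]) \<in> paths Q \<and> R a b} =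
     {f \<in> carrier (path_algebra Q). \<forall>x. reduced R x \<longrightarrow> f x = 0}"
    (is "Idl\<^bsub>?P\<^esub> ?S = ?J")
proof
  interpret fin_digraph Q
    by (rule assms)
  interpret P: ring ?P
    by (rule path_algebra_ring) simp
  have S: "?S \<subseteq> carrier ?P"
    by (auto intro: path_vector_closed)
  have "ideal ?J ?P"
  proof (rule idealI)
    show "subgroup ?J (add_monoid ?P)"
    proof
      fix f
      assume f: "f \<in> ?J"
      have "(\<ominus>\<^bsub>?P\<^esub> f) x = 0" if "reduced R x" for x
      proof -
        have "f x + (\<ominus>\<^bsub>?P\<^esub> f) x = 0"
          using f P.r_neg[of f] path_add[of Q f "\<ominus>\<^bsub>?P\<^esub> f" x] path_zero[of Q x] by simp
        then show ?thesis
          using f that by (cases x) simp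
      qed
      then have "\<ominus>\<^bsub>?P\<^esub> f \<in> ?J"
        using f by auto
      then show "inv\<^bsub>add_monoid ?P\<^esub> f \<in> ?J"
        by (simp only: a_inv_def)
    qed (auto simp: path_add path_zero)
    fix f g
    assume f: "f \<in> ?J" and g: "g \<in> carrier ?P"
    have "(g \<otimes>\<^bsub>?P\<^esub> f) (u, p) = 0 \<and> (f \<otimes>\<^bsub>?P\<^esub> g) (u, p) = 0" if red: "reduced R (u, p)" for u p
    proof (rule ccontr)
      assume "\<not> ?thesis"
      then obtain q r where p: "p = q @ r" and "f (u, q) \<noteq> 0 \<or> f (path_end Q (u, q), r) \<noteq> 0"
        by (meson path_mult_nonzeroE)
      moreover have "reduced R (u, q)" "reduced R (path_end Q (u, q), r)"
        using red unfolding p by (rule reduced_appendD)+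
      ultimately show False
        using f by simp
    qed
    then show "g \<otimes>\<^bsub>?P\<^esub> f \<in> ?J" "f \<otimes>\<^bsub>?P\<^esub> g \<in> ?J"
      using f g path_mult_closed by auto
  qed (rule P.ring_axioms)
  moreover have "?S \<subseteq> ?J"
  proof
    fix f
    assume f: "f \<in> ?S"
    then have "f x = 0" if "reduced R x" for x
      using that by (auto simp: path_vector_def reduced_def)
    then show "f \<in> ?J"
      using f S by blast
  qed
  ultimately show "Idl\<^bsub>?P\<^esub> ?S \<subseteq> ?J"
    by (rule P.genideal_minimal)
  interpret I: ideal "Idl\<^bsub>?P\<^esub> ?S" ?P
    by (rule P.genideal_ideal[OF S])
  have vec: "(\<lambda>y. c * path_vector x y) \<in> Idl\<^bsub>?P\<^esub> ?S" if x: "x \<in> paths Q" "\<not> reduced R x" for c x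
  proof -
    obtain u l a b r where ur: "x = (u, l @ [a, b] @ r)" and R: "R a b"
      using x(2) by (metis not_reducedE surj_pair)
    let ?v = "path_end Q (u, l)" and ?w = "path_end Q (u, l @ [a, b])"
    have p: "(u, l) \<in> paths Q" "(?v, [a, b]) \<in> paths Q" "(?w, r) \<in> paths Q"
      using x(1) by (auto simp: ur paths_append path_end_append simp del: append_Cons append_Nil)
    let ?f = "\<lambda>y. c * path_vector (u, l) y"
    have "path_vector (?v, [a, b]) \<in> Idl\<^bsub>?P\<^esub> ?S"
      using P.genideal_self[OF S] p R by blast
    then have "(?f \<otimes>\<^bsub>?P\<^esub> path_vector (?v, [a, b])) \<otimes>\<^bsub>?P\<^esub> path_vector (?w, r) \<in> Idl\<^bsub>?P\<^esub> ?S"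
      using p by (intro I.I_r_closed I.I_l_closed path_vector_closed path_vector_scaled_closed)
    then show ?thesis
      by (simp add: path_vector_scaled_mult path_vector_mult ur del: append_Cons append_Nil)
  qed
  show "?J \<subseteq> Idl\<^bsub>?P\<^esub> ?S"
  proof
    fix f
    assume f: "f \<in> ?J"
    have "g \<in> Idl\<^bsub>?P\<^esub> ?S"
      if "finite X" "{x. g x \<noteq> 0} \<subseteq> X" "X \<subseteq> {x \<in> paths Q. \<not> reduced R x}" for X g
      using that
    proof (induction X arbitrary: g rule: finite_induct)
      case empty
      then have "g = \<zero>\<^bsub>?P\<^esub>"
        by (auto simp: path_zero)
      then show ?case
        by simp
    next
      case (insert x X)
      have "(\<lambda>y. g x * path_vector x y) \<in> Idl\<^bsub>?P\<^esub> ?S"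
        using insert.prems by (intro vec) auto
      moreover have "g(x := 0) \<in> Idl\<^bsub>?P\<^esub> ?S"
        using insert.prems by (intro insert.IH) auto
      ultimately have "(\<lambda>y. g x * path_vector x y) \<oplus>\<^bsub>?P\<^esub> g(x := 0) \<in> Idl\<^bsub>?P\<^esub> ?S"
        by (rule I.a_closed)
      also have "(\<lambda>y. g x * path_vector x y) \<oplus>\<^bsub>?P\<^esub> g(x := 0) = g"
        by (auto simp: path_add path_vector_def)
      finally show ?case .
    qed
    moreover have "{x. f x \<noteq> 0} \<subseteq> {x \<in> paths Q. \<not> reduced R x}" "finite {x. f x \<noteq> 0}"
      using f path_carrier_iff[of f Q] by blast+
    ultimately show "f \<in> Idl\<^bsub>?P\<^esub> ?S"
      by blast
  qed
qed

section \<open>Gradings read off from coordinates\<close>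

text \<open>
  All gradings below arise in the same way: elements are described by finitely supported functions on
  a set whose members have a degree, and the homogeneous elements are those with support in a single
  degree. Cutting the function of \<open>x\<close> along the fibres of \<open>deg\<close> yields the components of \<open>x\<close>; they are
  unique because homogeneous elements of different degrees have disjoint supports.
\<close>
lemma internal_direct_sum_by_coordinates:
  fixes M :: "('m, 'z) ring_scheme" and \<phi> :: "'m \<Rightarrow> 's \<Rightarrow> complex" and deg :: "'s \<Rightarrow> int"
  assumes "abelian_group M"
    and add: "\<And>x y s. \<lbrakk>x \<in> carrier M; y \<in> carrier M\<rbrakk> \<Longrightarrow> \<phi> (x \<oplus>\<^bsub>M\<^esub> y) s = \<phi> x s + \<phi> y s"
    and inj: "\<And>x y. \<lbrakk>x \<in> carrier M; y \<in> carrier M; \<And>s. \<phi> x s = \<phi> y s\<rbrakk> \<Longrightarrow> x = y"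
    and fin: "\<And>x. x \<in> carrier M \<Longrightarrow> finite {s. \<phi> x s \<noteq> 0}"
    and part: "\<And>x m. x \<in> carrier M \<Longrightarrow>
      \<exists>y\<in>carrier M. \<forall>s. \<phi> y s = (if deg s = m then \<phi> x s else 0)"
    and D: "\<And>m. D m = {x \<in> carrier M. \<forall>s. \<phi> x s \<noteq> 0 \<longrightarrow> deg s = m}"
  shows "internal_direct_sum M D"
proof -
  interpret abelian_group M
    by (rule assms(1))
  have zero: "\<phi> \<zero>\<^bsub>M\<^esub> s = 0" for s
    using add[of "\<zero>\<^bsub>M\<^esub>" "\<zero>\<^bsub>M\<^esub>" s] by simp
  have neg: "\<phi> (\<ominus>\<^bsub>M\<^esub> x) s = - \<phi> x s" if "x \<in> carrier M" for x s
    using add[of x "\<ominus>\<^bsub>M\<^esub> x" s] that by (simp add: r_neg zero eq_neg_iff_add_eq_0 add.commute)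
  have nonzero: "\<exists>s. \<phi> x s \<noteq> 0" if "x \<in> carrier M" "x \<noteq> \<zero>\<^bsub>M\<^esub>" for x
    using inj[of x "\<zero>\<^bsub>M\<^esub>"] that zero by auto
  have sum: "\<phi> (\<Oplus>\<^bsub>M\<^esub>k\<in>K. g k) s = (\<Sum>k\<in>K. \<phi> (g k) s)" if "finite K" "g \<in> K \<rightarrow> carrier M" for K g s
    using that by (induction K rule: finite_induct) (auto simp: zero add Pi_def)
  have sub: "additive_subgroup (D m) M" for m
  proof (rule additive_subgroupI)
    show "subgroup (D m) (add_monoid M)"
    proof
      fix x
      assume "x \<in> D m"
      then have "\<ominus>\<^bsub>M\<^esub> x \<in> D m"
        by (auto simp: D neg)
      then show "inv\<^bsub>add_monoid M\<^esub> x \<in> D m"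
        by (simp only: a_inv_def)
    next
      fix x y
      assume "x \<in> D m" "y \<in> D m"
      then have "x \<oplus>\<^bsub>M\<^esub> y \<in> D m"
        unfolding D by (auto simp: add) (metis add.right_neutral)
      then show "x \<otimes>\<^bsub>add_monoid M\<^esub> y \<in> D m"
        by simp
    qed (auto simp: D zero)
  qed
  have ex1: "\<exists>!f. (\<forall>m. f m \<in> D m) \<and> finite {m. f m \<noteq> \<zero>\<^bsub>M\<^esub>} \<and>
      x = (\<Oplus>\<^bsub>M\<^esub>m\<in>{m. f m \<noteq> \<zero>\<^bsub>M\<^esub>}. f m)" if x: "x \<in> carrier M" for x
  proof -
    obtain g where g: "\<And>m. g m \<in> carrier M"
      and \<phi>g: "\<And>m s. \<phi> (g m) s = (if deg s = m then \<phi> x s else 0)"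
      using part[OF x] by metis
    show ?thesis
    proof (rule ex1I)
      have "{m. g m \<noteq> \<zero>\<^bsub>M\<^esub>} \<subseteq> deg ` {s. \<phi> x s \<noteq> 0}"
        using nonzero g \<phi>g by (force split: if_splits)
      then have f: "finite {m. g m \<noteq> \<zero>\<^bsub>M\<^esub>}"
        using fin[OF x] finite_subset by blast
      moreover have "x = (\<Oplus>\<^bsub>M\<^esub>m\<in>{m. g m \<noteq> \<zero>\<^bsub>M\<^esub>}. g m)"
      proof (rule inj)
        fix s
        have "\<phi> (\<Oplus>\<^bsub>M\<^esub>m\<in>{m. g m \<noteq> \<zero>\<^bsub>M\<^esub>}. g m) s = (\<Sum>m\<in>{m. g m \<noteq> \<zero>\<^bsub>M\<^esub>}. if deg s = m then \<phi> x s else 0)"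
          using f g by (simp add: sum \<phi>g)
        also have "\<dots> = \<phi> x s"
          using f \<phi>g[of "deg s" s] zero[of s] by auto
        finally show "\<phi> x s = \<phi> (\<Oplus>\<^bsub>M\<^esub>m\<in>{m. g m \<noteq> \<zero>\<^bsub>M\<^esub>}. g m) s" ..
      qed (use x g in auto)
      ultimately show "(\<forall>m. g m \<in> D m) \<and> finite {m. g m \<noteq> \<zero>\<^bsub>M\<^esub>} \<and>
          x = (\<Oplus>\<^bsub>M\<^esub>m\<in>{m. g m \<noteq> \<zero>\<^bsub>M\<^esub>}. g m)"
        using g by (auto simp: D \<phi>g)
    next
      fix h
      assume h: "(\<forall>m. h m \<in> D m) \<and> finite {m. h m \<noteq> \<zero>\<^bsub>M\<^esub>} \<and>
          x = (\<Oplus>\<^bsub>M\<^esub>m\<in>{m. h m \<noteq> \<zero>\<^bsub>M\<^esub>}. h m)"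
      let ?K = "{m. h m \<noteq> \<zero>\<^bsub>M\<^esub>}"
      have hc: "h m \<in> carrier M" and hD: "\<phi> (h m) s \<noteq> 0 \<Longrightarrow> deg s = m" for m s
        using h D by auto
      have \<phi>x: "\<phi> x s = \<phi> (h (deg s)) s" for s
      proof -
        have "\<phi> x s = (\<Sum>m\<in>?K. \<phi> (h m) s)"
          using h hc sum[of ?K h s] by auto
        also have "\<dots> = (\<Sum>m\<in>?K. if m = deg s then \<phi> (h (deg s)) s else 0)"
          using hD by (intro sum.cong) auto
        also have "\<dots> = \<phi> (h (deg s)) s"
          using h zero[of s] by auto
        finally show ?thesis .
      qed
      show "h = g"
      proof
        fix m
        show "h m = g m"
          using hc g hD by (intro inj) (auto simp: \<phi>g \<phi>x)
      qed
    qed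
  qed
  show ?thesis
    using sub ex1 by (simp add: internal_direct_sum_def)
qed

section \<open>Coordinates on the bipartite algebra\<close>

text \<open>
  Along a path every arrow starts where the previous one ended, so a path with these two arrows leads
  from \<open>part0\<close> through \<open>part1\<close> and back to \<open>part0\<close>: these are the relations of the bipartite algebra.
\<close>
definition returns_to_part0 :: "'e \<times> bool \<Rightarrow> 'e \<times> bool \<Rightarrow> bool" where
  "returns_to_part0 a b \<longleftrightarrow> snd a \<and> \<not> snd b"

text \<open>
  The ideal consists of functions that vanish at all reduced paths, so any representative of \<open>a\<close> may
  be evaluated at a reduced path. With the value \<open>0\<close> at the other paths, \<open>coord a\<close> is itself a
  representative of \<open>a\<close>, the only one supported on reduced paths.
\<close>
definition coord :: "('v, 'e) bip \<Rightarrow> ('v, 'e \<times> bool) path \<Rightarrow> complex" where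
  "coord a x = (if reduced returns_to_part0 x then the_elem ((\<lambda>f. f x) ` a) else 0)"

lemma coord_not_reduced: "\<not> reduced returns_to_part0 x \<Longrightarrow> coord a x = 0"
  by (simp add: coord_def)

definition arrow_class :: "('v, 'e) bipartite_graph \<Rightarrow> 'e \<times> bool \<Rightarrow> ('v, 'e) bip" where
  "arrow_class B a = bip_class B (path_vector (tail (double_quiver B) a, [a]))"

locale finite_bipartite =
  fixes B :: "('v, 'e) bipartite_graph"
  assumes finite_bipartite: "finite_bipartite_graph B"
begin

abbreviation Q where "Q \<equiv> double_quiver B"
abbreviation PA where "PA \<equiv> path_algebra Q"
abbreviation A where "A \<equiv> bipartite_algebra B"

sublocale Q: fin_digraph Q
  using finite_bipartite
  by unfold_locales
    (auto simp: double_quiver_def finite_bipartite_graph_def vertices_def split: if_splits)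

sublocale PA: ring PA
  by (rule Q.path_algebra_ring) simp

lemma verts_quiver [simp]: "verts Q = vertices B"
  by (simp add: double_quiver_def)

lemma tail_part0_iff: "a \<in> arcs Q \<Longrightarrow> tail Q a \<in> part0 B \<longleftrightarrow> snd a"
  and head_part0_iff: "a \<in> arcs Q \<Longrightarrow> head Q a \<in> part0 B \<longleftrightarrow> \<not> snd a"
  using finite_bipartite by (auto simp: double_quiver_def finite_bipartite_graph_def split: if_splits)

lemma bipartite_ideal_eq:
  "bipartite_ideal B = {f \<in> carrier PA. \<forall>x. reduced returns_to_part0 x \<longrightarrow> f x = 0}"
proof -
  have "{path_vector x | x. x \<in> paths Q \<and> path_length x = 2 \<and>
          path_start x \<in> part0 B \<and> path_end Q x \<in> part0 B} =
      {path_vector (u, [a, b]) | u a b. (u, [a, b]) \<in> paths Q \<and> returns_to_part0 a b}" (is "?L = ?R")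
  proof -
    have ends: "path_start (u, [a, b]) \<in> part0 B \<and> path_end Q (u, [a, b]) \<in> part0 B \<longleftrightarrow>
        returns_to_part0 a b" if "(u, [a, b]) \<in> paths Q" for u a b
      using that by (simp add: path_start_def path_end_conv Q.paths_Cons tail_part0_iff
          head_part0_iff returns_to_part0_def)
    have "path_length x = 2 \<longleftrightarrow> (\<exists>u a b. x = (u, [a, b]))" for x :: "('v, 'e \<times> bool) path"
      by (cases x) (auto simp: path_length_def length_Suc_conv numeral_2_eq_2)
    then have "(x \<in> paths Q \<and> path_length x = 2 \<and> path_start x \<in> part0 B \<and> path_end Q x \<in> part0 B) \<longleftrightarrow>
        (\<exists>u a b. x = (u, [a, b]) \<and> (u, [a, b]) \<in> paths Q \<and> returns_to_part0 a b)" for x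
      by (metis ends)
    then show ?thesis
      by (simp only: ) blast
  qed
  then show ?thesis
    unfolding bipartite_ideal_def using quadratic_monomial_ideal[OF Q.fin_digraph_axioms] by simp
qed

sublocale I: ideal "bipartite_ideal B" PA
  unfolding bipartite_ideal_def
  by (rule PA.genideal_ideal) (auto intro: path_vector_closed)

sublocale A: ring A
  unfolding bipartite_algebra_def by (rule I.quotient_is_ring)

lemma class_closed: "f \<in> carrier PA \<Longrightarrow> bip_class B f \<in> carrier A"
  by (auto simp: bipartite_algebra_def FactRing_def bip_class_def A_RCOSETS_def')

lemma classE:
  assumes "a \<in> carrier A"
  obtains f where "f \<in> carrier PA" "a = bip_class B f"
proof -
  have "carrier A = bip_class B ` carrier PA"
    by (auto simp: bipartite_algebra_def FactRing_def bip_class_def A_RCOSETS_def')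
  then show thesis
    using assms that by blast
qed

lemma class_add:
  "\<lbrakk>f \<in> carrier PA; g \<in> carrier PA\<rbrakk> \<Longrightarrow> bip_class B f \<oplus>\<^bsub>A\<^esub> bip_class B g = bip_class B (f \<oplus>\<^bsub>PA\<^esub> g)"
  by (simp add: bipartite_algebra_def FactRing_def bip_class_def I.a_rcos_sum)

lemma class_mult:
  "\<lbrakk>f \<in> carrier PA; g \<in> carrier PA\<rbrakk> \<Longrightarrow> bip_class B f \<otimes>\<^bsub>A\<^esub> bip_class B g = bip_class B (f \<otimes>\<^bsub>PA\<^esub> g)"
  by (simp add: bipartite_algebra_def FactRing_def bip_class_def I.rcoset_mult_add)

lemma coord_class:
  assumes "f \<in> carrier PA"
  shows "coord (bip_class B f) x = (if reduced returns_to_part0 x then f x else 0)"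
proof (cases "reduced returns_to_part0 x")
  case True
  have "(\<lambda>g. g x) ` bip_class B f = {f x}"
  proof -
    have "\<forall>h\<in>bipartite_ideal B. h x = 0"
      using True unfolding bipartite_ideal_eq by blast
    moreover have "bip_class B f = (\<lambda>h. h \<oplus>\<^bsub>PA\<^esub> f) ` bipartite_ideal B"
      unfolding bip_class_def a_r_coset_def' by blast
    ultimately have "(\<lambda>g. g x) ` bip_class B f = (\<lambda>h. f x) ` bipartite_ideal B"
      by (auto simp: image_image path_add intro!: image_cong)
    then show ?thesis
      by (simp add: image_constant[OF I.zero_closed])
  qed
  then show ?thesis
    by (simp add: coord_def)
qed (simp add: coord_def)

lemma coord_eqI:
  assumes a: "a \<in> carrier A" and b: "b \<in> carrier A" and eq: "\<And>x. coord a x = coord b x"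
  shows "a = b"
proof -
  obtain f where f: "f \<in> carrier PA" "a = bip_class B f"
    using a by (rule classE)
  obtain g where g: "g \<in> carrier PA" "b = bip_class B g"
    using b by (rule classE)
  have "(f \<ominus>\<^bsub>PA\<^esub> g) x = 0" if "reduced returns_to_part0 x" for x
  proof -
    have "((f \<ominus>\<^bsub>PA\<^esub> g) \<oplus>\<^bsub>PA\<^esub> g) x = f x"
      using f g by (simp add: PA.minus_eq PA.a_assoc PA.l_neg)
    moreover have "f x = g x"
      using eq[of x] f g that by (simp add: coord_class)
    ultimately show ?thesis
      by (simp add: path_add)
  qed
  then have "f \<ominus>\<^bsub>PA\<^esub> g \<in> bipartite_ideal B"
    using f g unfolding bipartite_ideal_eq by blast
  then have "bip_class B f = bip_class B g"
    unfolding bip_class_def using PA.quotient_eq_iff_same_a_r_cos[OF I.ideal_axioms f(1) g(1)] by blast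
  then show ?thesis
    by (simp only: f g)
qed

lemma coord_closed:
  assumes "a \<in> carrier A"
  shows "coord a \<in> carrier PA"
proof -
  obtain f where f: "f \<in> carrier PA" "a = bip_class B f"
    using assms by (rule classE)
  then show ?thesis
    by (intro path_carrier_subset[OF f(1)]) (simp add: coord_class split: if_splits)
qed

lemma class_coord:
  assumes "a \<in> carrier A"
  shows "bip_class B (coord a) = a"
proof (rule coord_eqI)
  show "coord (bip_class B (coord a)) x = coord a x" for x
    by (simp add: coord_class[OF coord_closed[OF assms]]) (simp add: coord_def)
qed (use assms in \<open>simp_all add: class_closed coord_closed\<close>)

lemma coord_add: "\<lbrakk>a \<in> carrier A; b \<in> carrier A\<rbrakk> \<Longrightarrow> coord (a \<oplus>\<^bsub>A\<^esub> b) x = coord a x + coord b x"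
  by (auto elim!: classE simp: class_add coord_class path_add)

lemma coord_mult:
  assumes "a \<in> carrier A" "b \<in> carrier A"
  shows "coord (a \<otimes>\<^bsub>A\<^esub> b) x = (if reduced returns_to_part0 x then (coord a \<otimes>\<^bsub>PA\<^esub> coord b) x else 0)"
proof -
  have "a \<otimes>\<^bsub>A\<^esub> b = bip_class B (coord a \<otimes>\<^bsub>PA\<^esub> coord b)"
    using assms by (simp add: class_mult[symmetric] coord_closed class_coord)
  then show ?thesis
    using assms by (simp add: coord_class coord_closed)
qed

lemma coord_zero [simp]: "coord \<zero>\<^bsub>A\<^esub> x = 0"
  using coord_add[of "\<zero>\<^bsub>A\<^esub>" "\<zero>\<^bsub>A\<^esub>" x] by simp

lemma coord_sum:
  "\<lbrakk>finite K; g \<in> K \<rightarrow> carrier A\<rbrakk> \<Longrightarrow> coord (\<Oplus>\<^bsub>A\<^esub>k\<in>K. g k) x = (\<Sum>k\<in>K. coord (g k) x)"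
  by (induction K rule: finite_induct) (auto simp: coord_add Pi_def)

lemma coord_nonzeroD:
  assumes "a \<in> carrier A" "coord a x \<noteq> 0"
  shows "reduced returns_to_part0 x" "x \<in> paths Q"
proof -
  show "reduced returns_to_part0 x"
    using assms(2) by (simp add: coord_def split: if_splits)
  show "x \<in> paths Q"
    using assms coord_closed unfolding path_carrier_iff by blast
qed

lemma ex_coord:
  assumes "a \<in> carrier A" "\<And>x. f x \<noteq> 0 \<Longrightarrow> coord a x \<noteq> 0"
  shows "\<exists>b\<in>carrier A. \<forall>x. coord b x = f x"
proof -
  have f: "f \<in> carrier PA"
    using assms by (intro path_carrier_subset[OF coord_closed[OF assms(1)]])
  moreover have "f x = 0" if "\<not> reduced returns_to_part0 x" for x
    using assms coord_nonzeroD that by blast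
  ultimately show ?thesis
    by (intro bexI[of _ "bip_class B f"] class_closed) (auto simp: coord_class)
qed

lemma idem_closed: "j \<in> vertices B \<Longrightarrow> bip_idem B j \<in> carrier A"
  unfolding bip_idem_def by (intro class_closed path_vector_closed) (simp add: Q.paths_Nil)

lemma coord_mult_idem:
  assumes "a \<in> carrier A" "j \<in> vertices B"
  shows "coord (a \<otimes>\<^bsub>A\<^esub> bip_idem B j) x = (if path_end Q x = j then coord a x else 0)"
proof -
  obtain u p where x: "x = (u, p)"
    by fastforce
  have v: "path_vector (j, []) \<in> carrier PA"
    using assms by (intro path_vector_closed) (simp add: Q.paths_Nil)
  have "coord (bip_idem B j) = path_vector (j, [])"
    by (simp add: bip_idem_def coord_class[OF v] fun_eq_iff) (simp add: path_vector_def)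
  then show ?thesis
    using assms mult_path_vector[of "[]" "[]" Q "coord a" j u p]
    by (simp add: x coord_mult idem_closed coord_not_reduced)
qed

lemma arrow_path: "a \<in> arcs Q \<Longrightarrow> (tail Q a, [a]) \<in> paths Q"
  using Q.head_in_verts[of a] by (simp add: Q.paths_Cons Q.paths_Nil)

lemma arrow_closed: "a \<in> arcs Q \<Longrightarrow> arrow_class B a \<in> carrier A"
  unfolding arrow_class_def by (intro class_closed path_vector_closed arrow_path)

lemma coord_mult_arrow:
  assumes "x \<in> carrier A" "a \<in> arcs Q"
  shows "coord (x \<otimes>\<^bsub>A\<^esub> arrow_class B a) (u, []) = 0"
    and "reduced returns_to_part0 (u, p @ [b]) \<Longrightarrow> coord (x \<otimes>\<^bsub>A\<^esub> arrow_class B a) (u, p @ [b]) =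
      (if b = a \<and> path_end Q (u, p) = tail Q a then coord x (u, p) else 0)"
proof -
  note v = path_vector_closed[OF arrow_path[OF assms(2)]]
  have "coord (arrow_class B a) = path_vector (tail Q a, [a])"
    by (simp add: arrow_class_def coord_class[OF v] fun_eq_iff) (simp add: path_vector_def)
  then show "coord (x \<otimes>\<^bsub>A\<^esub> arrow_class B a) (u, []) = 0"
    and "reduced returns_to_part0 (u, p @ [b]) \<Longrightarrow> coord (x \<otimes>\<^bsub>A\<^esub> arrow_class B a) (u, p @ [b]) =
      (if b = a \<and> path_end Q (u, p) = tail Q a then coord x (u, p) else 0)"
    using assms mult_path_vector[of "[b]" "[a]" Q "coord x" "tail Q a" u p]
    by (auto simp: coord_mult arrow_closed mult_path_vector_short)
qed

lemma component_iff:
  "a \<in> bip_component B m \<longleftrightarrow>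
     a \<in> carrier A \<and> (\<forall>x. coord a x \<noteq> 0 \<longrightarrow> int (path_length x) = m)"
proof
  assume "a \<in> bip_component B m"
  then show "a \<in> carrier A \<and> (\<forall>x. coord a x \<noteq> 0 \<longrightarrow> int (path_length x) = m)"
    by (auto simp: bip_component_def path_algebra_component_def coord_class class_closed split: if_splits)
next
  assume a: "a \<in> carrier A \<and> (\<forall>x. coord a x \<noteq> 0 \<longrightarrow> int (path_length x) = m)"
  then have "coord a \<in> path_algebra_component Q m"
    by (auto simp: path_algebra_component_def coord_closed)
  then show "a \<in> bip_component B m"
    using a class_coord unfolding bip_component_def by (metis imageI)
qed

lemma component_mult:
  assumes "a \<in> bip_component B k" "b \<in> bip_component B m"
  shows "a \<otimes>\<^bsub>A\<^esub> b \<in> bip_component B (k + m)"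
proof -
  have "int (path_length (u, p)) = k + m" if "coord (a \<otimes>\<^bsub>A\<^esub> b) (u, p) \<noteq> 0" for u p
  proof -
    have "(coord a \<otimes>\<^bsub>PA\<^esub> coord b) (u, p) \<noteq> 0"
      using assms that by (simp add: component_iff coord_mult split: if_splits)
    then obtain q r where "p = q @ r" "coord a (u, q) \<noteq> 0" "coord b (path_end Q (u, q), r) \<noteq> 0"
      by (rule path_mult_nonzeroE)
    then show ?thesis
      using assms by (fastforce simp: component_iff path_length_def)
  qed
  then show ?thesis
    using assms by (auto simp: component_iff)
qed

lemma bipartite_algebra_graded: "graded_ring A (bip_component B)"
proof -
  have "internal_direct_sum A (bip_component B)"
  proof (rule internal_direct_sum_by_coordinates[where \<phi> = coord and deg = "int \<circ> path_length"])
    fix a m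
    assume "a \<in> carrier A"
    then show "\<exists>b\<in>carrier A. \<forall>x. coord b x = (if (int \<circ> path_length) x = m then coord a x else 0)"
      by (intro ex_coord[of a]) (auto split: if_splits)
  next
    fix a
    assume "a \<in> carrier A"
    then show "finite {x. coord a x \<noteq> 0}"
      using coord_closed path_carrier_iff by blast
  next
    fix a b
    assume "a \<in> carrier A" "b \<in> carrier A" "\<And>x. coord a x = coord b x"
    then show "a = b"
      by (rule coord_eqI)
  qed (auto simp: coord_add component_iff A.abelian_group_axioms)
  then show ?thesis
    by (simp add: graded_ring_def A.ring_axioms component_mult)
qed

end

section \<open>Graded modules over the bipartite algebra\<close>

lemma left_module_shift:
  "left_module R M \<Longrightarrow> left_module R (grading_shift k M)"
  by (simp add: grading_shift_def left_module_def left_module_axioms_def abelian_group_def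
      abelian_group_axioms_def abelian_monoid_def)

lemma left_module_direct_sum:
  assumes R: "ring R" and Ms: "\<And>M. M \<in> set Ms \<Longrightarrow> left_module R M"
  shows "left_module R (graded_direct_sum Ms)"
proof -
  let ?I = "{..<length Ms}"
  let ?S = "graded_direct_sum Ms"
  have lm: "left_module R (Ms ! r)" if "r \<in> ?I" for r
    using Ms that by simp
  note ag = left_module.axioms(2)[OF lm]
  note am = abelian_group.axioms(1)[OF ag]
  have carrier: "carrier ?S = (\<Pi>\<^sub>E r\<in>?I. carrier (Ms ! r))"
    and zero: "\<zero>\<^bsub>?S\<^esub> = (\<lambda>r\<in>?I. \<zero>\<^bsub>Ms ! r\<^esub>)"
    and add: "\<And>x y. x \<oplus>\<^bsub>?S\<^esub> y = (\<lambda>r\<in>?I. x r \<oplus>\<^bsub>Ms ! r\<^esub> y r)"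
    and smult: "\<And>a x. a \<odot>\<^bsub>?S\<^esub> x = (\<lambda>r\<in>?I. a \<odot>\<^bsub>Ms ! r\<^esub> x r)"
    by (simp_all add: graded_direct_sum_def)
  note ops = carrier zero add smult
  have mem: "x r \<in> carrier (Ms ! r)" if "x \<in> carrier ?S" "r \<in> ?I" for x r
    using that unfolding carrier by (rule PiE_mem)
  have eqI: "(\<lambda>r\<in>?I. f r) = x" if "x \<in> carrier ?S" "\<And>r. r \<in> ?I \<Longrightarrow> f r = x r" for f x
    using that unfolding carrier PiE_def by (intro extensionalityI[of _ ?I]) auto
  have "abelian_group ?S"
  proof (rule abelian_groupI)
    fix x
    assume x: "x \<in> carrier ?S"
    show "\<zero>\<^bsub>?S\<^esub> \<oplus>\<^bsub>?S\<^esub> x = x"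
      unfolding add by (intro eqI[OF x]) (simp add: zero abelian_monoid.l_zero[OF am] mem[OF x])
    show "\<exists>y\<in>carrier ?S. y \<oplus>\<^bsub>?S\<^esub> x = \<zero>\<^bsub>?S\<^esub>"
    proof
      show "(\<lambda>r\<in>?I. \<ominus>\<^bsub>Ms ! r\<^esub> x r) \<in> carrier ?S"
        unfolding carrier by (intro restrict_PiE_iff[THEN iffD2] ballI abelian_group.a_inv_closed[OF ag] mem[OF x])
      show "(\<lambda>r\<in>?I. \<ominus>\<^bsub>Ms ! r\<^esub> x r) \<oplus>\<^bsub>?S\<^esub> x = \<zero>\<^bsub>?S\<^esub>"
        unfolding add zero by (intro restrict_ext) (simp add: abelian_group.l_neg[OF ag] mem[OF x])
    qed
    fix y
    assume y: "y \<in> carrier ?S"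
    show "x \<oplus>\<^bsub>?S\<^esub> y \<in> carrier ?S"
      unfolding carrier add
      by (intro restrict_PiE_iff[THEN iffD2] ballI abelian_monoid.a_closed[OF am] mem x y)
    show "x \<oplus>\<^bsub>?S\<^esub> y = y \<oplus>\<^bsub>?S\<^esub> x"
      unfolding add by (intro restrict_ext) (simp add: abelian_monoid.a_comm[OF am] mem[OF x] mem[OF y])
    fix z
    assume z: "z \<in> carrier ?S"
    show "x \<oplus>\<^bsub>?S\<^esub> y \<oplus>\<^bsub>?S\<^esub> z = x \<oplus>\<^bsub>?S\<^esub> (y \<oplus>\<^bsub>?S\<^esub> z)"
      unfolding add
      by (intro restrict_ext) (simp add: abelian_monoid.a_assoc[OF am] mem[OF x] mem[OF y] mem[OF z])
  next
    show "\<zero>\<^bsub>?S\<^esub> \<in> carrier ?S"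
      unfolding carrier zero
      by (intro restrict_PiE_iff[THEN iffD2] ballI abelian_monoid.zero_closed[OF am])
  qed
  moreover have "left_module_axioms R ?S"
  proof
    fix a x
    assume a: "a \<in> carrier R" and x: "x \<in> carrier ?S"
    show "a \<odot>\<^bsub>?S\<^esub> x \<in> carrier ?S"
      unfolding carrier smult
      by (intro restrict_PiE_iff[THEN iffD2] ballI left_module.smult_closed[OF lm] mem a x)
    fix b
    assume b: "b \<in> carrier R"
    show "(a \<oplus>\<^bsub>R\<^esub> b) \<odot>\<^bsub>?S\<^esub> x = a \<odot>\<^bsub>?S\<^esub> x \<oplus>\<^bsub>?S\<^esub> b \<odot>\<^bsub>?S\<^esub> x"
      unfolding add smult
      by (intro restrict_ext) (simp add: left_module.smult_l_distr[OF lm] mem[OF x] a b)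
    show "(a \<otimes>\<^bsub>R\<^esub> b) \<odot>\<^bsub>?S\<^esub> x = a \<odot>\<^bsub>?S\<^esub> (b \<odot>\<^bsub>?S\<^esub> x)"
      unfolding smult by (intro restrict_ext) (simp add: left_module.smult_assoc1[OF lm] mem[OF x] a b)
  next
    fix a x y
    assume "a \<in> carrier R" and x: "x \<in> carrier ?S" and y: "y \<in> carrier ?S"
    then show "a \<odot>\<^bsub>?S\<^esub> (x \<oplus>\<^bsub>?S\<^esub> y) = a \<odot>\<^bsub>?S\<^esub> x \<oplus>\<^bsub>?S\<^esub> a \<odot>\<^bsub>?S\<^esub> y"
      unfolding add smult
      by (intro restrict_ext) (simp add: left_module.smult_r_distr[OF lm] mem[OF x] mem[OF y])
  next
    fix x
    assume x: "x \<in> carrier ?S"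
    show "\<one>\<^bsub>R\<^esub> \<odot>\<^bsub>?S\<^esub> x = x"
      unfolding smult by (intro eqI[OF x]) (simp add: left_module.smult_one[OF lm] mem[OF x])
  qed
  ultimately show ?thesis
    using R by (simp add: left_module_def)
qed

context finite_bipartite
begin

text \<open>
  Multiplication by the idempotent of \<open>j\<close> on the right keeps the coordinates at the paths that end at
  \<open>j\<close> and deletes the others.
\<close>
lemma projective_carrier_iff:
  assumes "j \<in> vertices B"
  shows "a \<in> carrier (bip_projective B j) \<longleftrightarrow>
    a \<in> carrier A \<and> (\<forall>x. coord a x \<noteq> 0 \<longrightarrow> path_end Q x = j)"
proof
  assume "a \<in> carrier (bip_projective B j)"
  then obtain b where "b \<in> carrier A" "a = b \<otimes>\<^bsub>A\<^esub> bip_idem B j"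
    by (auto simp: bip_projective_def Let_def)
  then show "a \<in> carrier A \<and> (\<forall>x. coord a x \<noteq> 0 \<longrightarrow> path_end Q x = j)"
    using assms idem_closed by (simp add: coord_mult_idem)
next
  assume a: "a \<in> carrier A \<and> (\<forall>x. coord a x \<noteq> 0 \<longrightarrow> path_end Q x = j)"
  then have "a = a \<otimes>\<^bsub>A\<^esub> bip_idem B j"
    using assms by (intro coord_eqI) (auto simp: coord_mult_idem idem_closed)
  then show "a \<in> carrier (bip_projective B j)"
    using a by (auto simp: bip_projective_def Let_def)
qed

lemma projective_ops [simp]:
  "\<zero>\<^bsub>bip_projective B j\<^esub> = \<zero>\<^bsub>A\<^esub>"
  "x \<oplus>\<^bsub>bip_projective B j\<^esub> y = x \<oplus>\<^bsub>A\<^esub> y"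
  "a \<odot>\<^bsub>bip_projective B j\<^esub> x = a \<otimes>\<^bsub>A\<^esub> x"
  "component (bip_projective B j) m = carrier (bip_projective B j) \<inter> bip_component B m"
  by (simp_all add: bip_projective_def Let_def)

lemma projective_left_module:
  assumes j: "j \<in> vertices B"
  shows "left_module A (bip_projective B j)"
proof -
  let ?P = "bip_projective B j"
  let ?e = "bip_idem B j"
  note e = idem_closed[OF j]
  have memE: "\<exists>b\<in>carrier A. x = b \<otimes>\<^bsub>A\<^esub> ?e" if "x \<in> carrier ?P" for x
    using that by (auto simp: bip_projective_def Let_def)
  have memI: "b \<otimes>\<^bsub>A\<^esub> ?e \<in> carrier ?P" if "b \<in> carrier A" for b
    using that by (auto simp: bip_projective_def Let_def)
  have sub: "x \<in> carrier A" if "x \<in> carrier ?P" for x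
    using memE[OF that] e by auto
  have "abelian_group ?P"
  proof (rule abelian_groupI)
    fix x
    assume x: "x \<in> carrier ?P"
    then obtain b where b: "b \<in> carrier A" "x = b \<otimes>\<^bsub>A\<^esub> ?e"
      using memE by blast
    then show "\<exists>y\<in>carrier ?P. y \<oplus>\<^bsub>?P\<^esub> x = \<zero>\<^bsub>?P\<^esub>"
      using memI[of "\<ominus>\<^bsub>A\<^esub> b"] e by (intro bexI[of _ "\<ominus>\<^bsub>A\<^esub> b \<otimes>\<^bsub>A\<^esub> ?e"]) (simp_all add: A.l_minus A.l_neg)
    fix y
    assume "y \<in> carrier ?P"
    then obtain c where c: "c \<in> carrier A" "y = c \<otimes>\<^bsub>A\<^esub> ?e"
      using memE by blast
    show "x \<oplus>\<^bsub>?P\<^esub> y \<in> carrier ?P"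
      using b c e memI[of "b \<oplus>\<^bsub>A\<^esub> c"] by (simp add: A.l_distr)
  next
    show "\<zero>\<^bsub>?P\<^esub> \<in> carrier ?P"
      using memI[of "\<zero>\<^bsub>A\<^esub>"] e by simp
  qed (auto dest!: sub simp: A.a_ac)
  moreover have "left_module_axioms A ?P"
  proof
    fix a x
    assume a: "a \<in> carrier A" and "x \<in> carrier ?P"
    then obtain b where b: "b \<in> carrier A" "x = b \<otimes>\<^bsub>A\<^esub> ?e"
      using memE by blast
    then show "a \<odot>\<^bsub>?P\<^esub> x \<in> carrier ?P"
      using memI[of "a \<otimes>\<^bsub>A\<^esub> b"] a e by (simp add: A.m_assoc)
  qed (auto dest!: sub simp: A.l_distr A.r_distr A.m_assoc)
  ultimately show ?thesis
    using A.ring_axioms by (simp add: left_module_def)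
qed

abbreviation projective_sum ::
  "nat \<Rightarrow> 'v list \<Rightarrow> (('v, 'e) bip, nat \<Rightarrow> ('v, 'e) bip) graded_module" where
  "projective_sum k js \<equiv> graded_direct_sum (map (\<lambda>j. grading_shift (int k) (bip_projective B j)) js)"

lemma sum_ops:
  "carrier (projective_sum k js) = (\<Pi>\<^sub>E r\<in>{..<length js}. carrier (bip_projective B (js ! r)))"
  "\<zero>\<^bsub>projective_sum k js\<^esub> = (\<lambda>r\<in>{..<length js}. \<zero>\<^bsub>A\<^esub>)"
  "x \<oplus>\<^bsub>projective_sum k js\<^esub> y = (\<lambda>r\<in>{..<length js}. x r \<oplus>\<^bsub>A\<^esub> y r)"
  "a \<odot>\<^bsub>projective_sum k js\<^esub> x = (\<lambda>r\<in>{..<length js}. a \<otimes>\<^bsub>A\<^esub> x r)"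
  "component (projective_sum k js) m =
     (\<Pi>\<^sub>E r\<in>{..<length js}. carrier (bip_projective B (js ! r)) \<inter> bip_component B (m - int k))"
  by (auto simp: graded_direct_sum_def grading_shift_def intro!: PiE_cong restrict_ext)

lemma sum_memD:
  assumes "set js \<subseteq> vertices B" "x \<in> carrier (projective_sum k js)" "r < length js"
  shows "x r \<in> carrier A" "coord (x r) p \<noteq> 0 \<Longrightarrow> path_end Q p = js ! r"
proof -
  have "x r \<in> carrier (bip_projective B (js ! r))"
    using assms by (auto simp: sum_ops)
  moreover have "js ! r \<in> vertices B"
    using assms by auto
  ultimately show "x r \<in> carrier A" "coord (x r) p \<noteq> 0 \<Longrightarrow> path_end Q p = js ! r"
    using projective_carrier_iff by blast+
qed

lemma sum_memI:
  assumes "set js \<subseteq> vertices B"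
    and "\<And>r. r < length js \<Longrightarrow> f r \<in> carrier A"
    and "\<And>r p. \<lbrakk>r < length js; coord (f r) p \<noteq> 0\<rbrakk> \<Longrightarrow> path_end Q p = js ! r"
  shows "(\<lambda>r\<in>{..<length js}. f r) \<in> carrier (projective_sum k js)"
proof -
  have "f r \<in> carrier (bip_projective B (js ! r))" if "r < length js" for r
    using assms that nth_mem[OF that] by (subst projective_carrier_iff) auto
  then show ?thesis
    by (simp add: sum_ops)
qed

lemma sum_eqI:
  assumes "set js \<subseteq> vertices B" "x \<in> carrier (projective_sum k js)" "y \<in> carrier (projective_sum k js)"
    and "\<And>r p. r < length js \<Longrightarrow> coord (x r) p = coord (y r) p"
  shows "x = y"
proof (rule PiE_ext)
  show "x \<in> (\<Pi>\<^sub>E r\<in>{..<length js}. carrier (bip_projective B (js ! r)))"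
    "y \<in> (\<Pi>\<^sub>E r\<in>{..<length js}. carrier (bip_projective B (js ! r)))"
    using assms by (simp_all add: sum_ops)
  show "x r = y r" if "r \<in> {..<length js}" for r
    using assms that sum_memD[OF assms(1)] by (intro coord_eqI) auto
qed

lemma sum_component_iff:
  assumes "set js \<subseteq> vertices B"
  shows "x \<in> component (projective_sum k js) m \<longleftrightarrow> x \<in> carrier (projective_sum k js) \<and>
    (\<forall>r<length js. \<forall>p. coord (x r) p \<noteq> 0 \<longrightarrow> int (path_length p) + int k = m)"
proof -
  have "x \<in> component (projective_sum k js) m \<longleftrightarrow> x \<in> carrier (projective_sum k js) \<and>
    (\<forall>r<length js. x r \<in> bip_component B (m - int k))"
    by (auto simp: sum_ops PiE_iff)
  moreover have "x r \<in> bip_component B (m - int k) \<longleftrightarrow>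
      (\<forall>p. coord (x r) p \<noteq> 0 \<longrightarrow> int (path_length p) + int k = m)"
    if "x \<in> carrier (projective_sum k js)" "r < length js" for r
    using sum_memD(1)[OF assms that] by (auto simp: component_iff algebra_simps)
  ultimately show ?thesis
    by blast
qed

text \<open>
  A finite sum of projectives has coordinates indexed by pairs of a summand and a reduced path; the
  shift adds \<open>k\<close> to the length of the path.
\<close>
lemma sum_graded:
  assumes js: "set js \<subseteq> vertices B"
  shows "graded_left_module A (bip_component B) (projective_sum k js)"
proof -
  let ?C = "projective_sum k js"
  have lm: "left_module A ?C"
    using js by (intro left_module_direct_sum A.ring_axioms)
      (auto intro: left_module_shift projective_left_module)
  interpret C: left_module A ?C
    by (rule lm)
  let ?\<phi> = "\<lambda>x (r, p). if r < length js then coord (x r) p else 0"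
  have "internal_direct_sum ?C (component ?C)"
  proof (rule internal_direct_sum_by_coordinates[where \<phi> = ?\<phi> and deg = "\<lambda>(r, p). int (path_length p) + int k"])
    fix x y s
    assume "x \<in> carrier ?C" "y \<in> carrier ?C"
    then show "?\<phi> (x \<oplus>\<^bsub>?C\<^esub> y) s = ?\<phi> x s + ?\<phi> y s"
      using sum_memD(1)[OF js] by (auto simp: sum_ops(3) coord_add split: prod.split)
  next
    fix x y
    assume xy: "x \<in> carrier ?C" "y \<in> carrier ?C" and eq: "\<And>s. ?\<phi> x s = ?\<phi> y s"
    show "x = y"
    proof (rule sum_eqI[OF js xy])
      show "coord (x r) p = coord (y r) p" if "r < length js" for r p
        using eq[of "(r, p)"] that by simp
    qed
  next
    fix x
    assume x: "x \<in> carrier ?C"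
    have "{s. ?\<phi> x s \<noteq> 0} \<subseteq> (SIGMA r:{..<length js}. {p. coord (x r) p \<noteq> 0})"
      by (auto split: if_splits)
    moreover have "finite {p. coord (x r) p \<noteq> 0}" if "r < length js" for r
      using coord_closed[OF sum_memD(1)[OF js x that]] path_carrier_iff by blast
    then have "finite (SIGMA r:{..<length js}. {p. coord (x r) p \<noteq> 0})"
      by (intro finite_SigmaI) auto
    ultimately show "finite {s. ?\<phi> x s \<noteq> 0}"
      by (rule finite_subset)
    fix m
    have "\<exists>b\<in>carrier A. \<forall>p. coord b p = (if int (path_length p) + int k = m then coord (x r) p else 0)"
      if "r < length js" for r
      using sum_memD(1)[OF js x that] by (intro ex_coord[of "x r"]) (auto split: if_splits)
    then obtain y where y: "\<And>r. r < length js \<Longrightarrow> y r \<in> carrier A"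
      and cy: "\<And>r p. r < length js \<Longrightarrow>
        coord (y r) p = (if int (path_length p) + int k = m then coord (x r) p else 0)"
      by metis
    have "(\<lambda>r\<in>{..<length js}. y r) \<in> carrier ?C"
      using y cy sum_memD(2)[OF js x] by (intro sum_memI[OF js]) (auto split: if_splits)
    then show "\<exists>y\<in>carrier ?C. \<forall>s. ?\<phi> y s =
        (if (case s of (r, p) \<Rightarrow> int (path_length p) + int k) = m then ?\<phi> x s else 0)"
      by (rule bexI[rotated]) (auto simp: cy)
  next
    fix m
    show "component ?C m =
        {x \<in> carrier ?C. \<forall>s. ?\<phi> x s \<noteq> 0 \<longrightarrow> (case s of (r, p) \<Rightarrow> int (path_length p) + int k) = m}"
      by (auto simp: set_eq_iff sum_component_iff[OF js])
  qed (rule C.M.abelian_group_axioms)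
  moreover have "a \<odot>\<^bsub>?C\<^esub> x \<in> component ?C (l + m)" if "a \<in> bip_component B l" "x \<in> component ?C m" for a x l m
  proof -
    have x: "x \<in> carrier ?C" "\<And>r. r < length js \<Longrightarrow> x r \<in> bip_component B (m - int k)"
      using that by (auto simp: sum_ops PiE_iff)
    have "a \<odot>\<^bsub>?C\<^esub> x \<in> carrier ?C"
      using that x by (intro C.smult_closed) (simp_all add: component_iff)
    moreover have "(a \<odot>\<^bsub>?C\<^esub> x) r \<in> bip_component B (l + m - int k)" if r: "r < length js" for r
      using component_mult[OF \<open>a \<in> bip_component B l\<close> x(2)[OF r]] r by (simp add: sum_ops add_diff_eq)
    ultimately show ?thesis
      unfolding sum_ops by (auto simp: PiE_iff)
  qed
  ultimately show ?thesis
    using lm by (simp add: graded_left_module_def bipartite_algebra_graded)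
qed

lemma coord_mult_Nil:
  assumes "a \<in> carrier A" "b \<in> carrier A"
  shows "coord (a \<otimes>\<^bsub>A\<^esub> b) (u, []) = coord a (u, []) * coord b (u, [])"
  using assms by (simp add: coord_mult path_mult)

lemma simple_ops:
  "carrier (bip_simple B i) = UNIV" "\<zero>\<^bsub>bip_simple B i\<^esub> = 0"
  "x \<oplus>\<^bsub>bip_simple B i\<^esub> y = x + y"
  "a \<odot>\<^bsub>bip_simple B i\<^esub> x = coord a (i, []) * x"
  "component (bip_simple B i) m = (if m = 0 then UNIV else {0})"
  by (simp_all add: bip_simple_def coord_def)

lemma simple_graded:
  assumes "i \<in> vertices B"
  shows "graded_left_module A (bip_component B) (bip_simple B i)"
proof -
  let ?L = "bip_simple B i"
  have ag: "abelian_group ?L"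
    by (rule abelian_groupI) (auto simp: simple_ops intro: exI[of _ "- x" for x])
  have one: "coord \<one>\<^bsub>A\<^esub> (i, []) = 1"
  proof -
    have "\<one>\<^bsub>A\<^esub> = bip_class B \<one>\<^bsub>PA\<^esub>"
      by (simp add: bipartite_algebra_def FactRing_def bip_class_def)
    then show ?thesis
      using assms by (simp add: coord_class) (simp add: path_algebra_def)
  qed
  have "left_module A ?L"
    unfolding left_module_def left_module_axioms_def
    using ag A.ring_axioms by (simp add: simple_ops coord_add coord_mult_Nil one algebra_simps)
  moreover have "internal_direct_sum ?L (component ?L)"
    by (rule internal_direct_sum_by_coordinates[where \<phi> = "\<lambda>z (_::unit). z" and deg = "\<lambda>_. 0"])
      (use ag in \<open>auto simp: simple_ops\<close>)
  moreover have "a \<odot>\<^bsub>?L\<^esub> z \<in> component ?L (k + m)" if "a \<in> bip_component B k" "z \<in> component ?L m" for a z k m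
    using that by (fastforce simp: simple_ops component_iff path_length_def split: if_splits)
  ultimately show ?thesis
    by (simp add: graded_left_module_def bipartite_algebra_graded)
qed

end

section \<open>The Koszul complex of a vertex\<close>

text \<open>
  The words of the Koszul complex are the paths to \<open>i\<close> in which every pair of consecutive arrows is a
  relation. They are recorded by their arrows alone: a nonempty list of arrows determines where it
  starts, and the empty list stands for the constant path at \<open>i\<close>.
\<close>
definition word_start :: "('v, 'e) bipartite_graph \<Rightarrow> 'v \<Rightarrow> ('e \<times> bool) list \<Rightarrow> 'v" where
  "word_start B i q = (if q = [] then i else tail (double_quiver B) (hd q))"

definition koszul_words :: "('v, 'e) bipartite_graph \<Rightarrow> 'v \<Rightarrow> nat \<Rightarrow> ('e \<times> bool) list set" where
  "koszul_words B i k =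
     {q. length q = k \<and> successively returns_to_part0 q \<and>
         (word_start B i q, q) \<in> paths (double_quiver B) \<and>
         path_end (double_quiver B) (word_start B i q, q) = i}"

text \<open>
  The summands of a direct sum are addressed by their position, so the words have to be put in some
  order. The position \<open>r\<close> in the term of degree \<open>k\<close> below always refers to the word \<open>koszul_list B i k ! r\<close>.
\<close>
definition koszul_list :: "('v, 'e) bipartite_graph \<Rightarrow> 'v \<Rightarrow> nat \<Rightarrow> ('e \<times> bool) list list" where
  "koszul_list B i k = (SOME ws. set ws = koszul_words B i k \<and> distinct ws)"

definition koszul_term ::
  "('v, 'e) bipartite_graph \<Rightarrow> 'v \<Rightarrow> nat \<Rightarrow> (('v, 'e) bip, nat \<Rightarrow> ('v, 'e) bip) graded_module" where
  "koszul_term B i k =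
     graded_direct_sum (map (\<lambda>j. grading_shift (int k) (bip_projective B j))
       (map (word_start B i) (koszul_list B i k)))"

definition extensions :: "('v, 'e) bipartite_graph \<Rightarrow> 'v \<Rightarrow> nat \<Rightarrow> nat \<Rightarrow> nat set" where
  "extensions B i k s =
     {r. r < length (koszul_list B i (Suc k)) \<and> tl (koszul_list B i (Suc k) ! r) = koszul_list B i k ! s}"

text \<open>
  On the basis of pairs of a reduced path \<open>p\<close> and a word \<open>a # w\<close> that starts at the end of \<open>p\<close>, the
  differential moves the first arrow of the word to the end of the path: it sends \<open>(p, a # w)\<close> to
  \<open>(p @ [a], w)\<close>, which is \<open>0\<close> when \<open>p @ [a]\<close> is not reduced.
\<close>
definition koszul_diff ::
  "('v, 'e) bipartite_graph \<Rightarrow> 'v \<Rightarrow> nat \<Rightarrow> (nat \<Rightarrow> ('v, 'e) bip) \<Rightarrow> nat \<Rightarrow> ('v, 'e) bip" where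
  "koszul_diff B i k x =
     (\<lambda>s\<in>{..<length (koszul_list B i k)}.
        \<Oplus>\<^bsub>bipartite_algebra B\<^esub>r\<in>extensions B i k s.
          x r \<otimes>\<^bsub>bipartite_algebra B\<^esub> arrow_class B (hd (koszul_list B i (Suc k) ! r)))"

definition augmentation :: "'v \<Rightarrow> (nat \<Rightarrow> ('v, 'e) bip) \<Rightarrow> complex" where
  "augmentation i x = coord (x 0) (i, [])"

locale bipartite_vertex = finite_bipartite B for B :: "('v, 'e) bipartite_graph" +
  fixes i :: 'v
  assumes vertex: "i \<in> vertices B"
begin

abbreviation W where "W \<equiv> koszul_words B i"
abbreviation ws where "ws \<equiv> koszul_list B i"
abbreviation C where "C \<equiv> koszul_term B i"
abbreviation d where "d \<equiv> koszul_diff B i"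

lemma words_0: "W 0 = {[]}"
  using vertex by (auto simp: koszul_words_def word_start_def Q.paths_Nil)

text \<open>
  The condition on the head of \<open>a\<close> covers two cases: for a nonempty \<open>q\<close> it makes \<open>a # q\<close> a walk, and for
  the empty word it makes \<open>a\<close> end at \<open>i\<close>.
\<close>
lemma Cons_word_iff:
  "a # q \<in> W (Suc k) \<longleftrightarrow> a \<in> arcs Q \<and> q \<in> W k \<and> head Q a = word_start B i q \<and>
     (q \<noteq> [] \<longrightarrow> returns_to_part0 a (hd q))"
proof -
  have "(head Q a, q) \<in> paths Q \<and> path_end Q (head Q a, q) = i \<longleftrightarrow>
      (word_start B i q, q) \<in> paths Q \<and> path_end Q (word_start B i q, q) = i \<and> head Q a = word_start B i q"
    using vertex by (cases q) (auto simp: word_start_def Q.paths_Cons Q.paths_Nil)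
  then show ?thesis
    by (auto simp: koszul_words_def successively_Cons Q.paths_Cons Q.path_end_Cons word_start_def)
qed

lemma words_Suc_cases:
  assumes "w \<in> W (Suc k)"
  obtains a q where "w = a # q" "q \<in> W k"
proof (cases w)
  case Nil
  then show ?thesis
    using assms by (simp add: koszul_words_def)
next
  case (Cons a q)
  then show ?thesis
    using assms that Cons_word_iff by blast
qed

lemma words_list: "set (ws k) = W k" "distinct (ws k)"
proof -
  have "set q \<subseteq> arcs Q" if "q \<in> W k" for q
    using that by (simp add: koszul_words_def paths_def pre_digraph.awalk_def)
  then have "W k \<subseteq> {q. set q \<subseteq> arcs Q \<and> length q = k}"
    by (auto simp: koszul_words_def)
  then have "finite (W k)"
    using finite_lists_length_eq[OF Q.finite_arcs] finite_subset by blast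
  then have "\<exists>l. set l = W k \<and> distinct l"
    using finite_distinct_list by blast
  then show "set (ws k) = W k" "distinct (ws k)"
    unfolding koszul_list_def by (metis (mono_tags, lifting) someI_ex)+
qed

lemma starts_vertices: "set (map (word_start B i) (ws k)) \<subseteq> vertices B"
proof -
  have "word_start B i q \<in> vertices B" if "q \<in> W k" for q
    using that Q.paths_append[of "word_start B i q" "[]" q] by (simp add: koszul_words_def Q.paths_Nil)
  then show ?thesis
    by (auto simp: words_list)
qed

lemma finite_extensions: "finite (extensions B i k s)"
  by (simp add: extensions_def)

lemma extension_hd:
  assumes "s < length (ws k)" "r \<in> extensions B i k s"
  shows "ws (Suc k) ! r = hd (ws (Suc k) ! r) # ws k ! s" "hd (ws (Suc k) ! r) \<in> arcs Q"
    "head Q (hd (ws (Suc k) ! r)) = word_start B i (ws k ! s)"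
proof -
  have r: "r < length (ws (Suc k))" "tl (ws (Suc k) ! r) = ws k ! s"
    using assms by (auto simp: extensions_def)
  have w: "ws (Suc k) ! r \<in> W (Suc k)"
    using nth_mem[OF r(1)] words_list by simp
  then show eq: "ws (Suc k) ! r = hd (ws (Suc k) ! r) # ws k ! s"
    using r(2) by (auto elim: words_Suc_cases)
  show "hd (ws (Suc k) ! r) \<in> arcs Q" "head Q (hd (ws (Suc k) ! r)) = word_start B i (ws k ! s)"
    using w Cons_word_iff[of "hd (ws (Suc k) ! r)" "ws k ! s" k] eq by auto
qed

lemma term_memD:
  assumes "x \<in> carrier (C k)" "r < length (ws k)"
  shows "x r \<in> carrier A" "coord (x r) p \<noteq> 0 \<Longrightarrow> path_end Q p = word_start B i (ws k ! r)"
proof -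
  have "x \<in> carrier (projective_sum k (map (word_start B i) (ws k)))"
    using assms by (simp only: koszul_term_def)
  note mem = sum_memD[OF starts_vertices this, of r]
  show "x r \<in> carrier A"
    using mem(1) assms by simp
  show "coord (x r) p \<noteq> 0 \<Longrightarrow> path_end Q p = word_start B i (ws k ! r)"
    using mem(2)[of p] assms by simp
qed

lemma term_memI:
  assumes "\<And>r. r < length (ws k) \<Longrightarrow> f r \<in> carrier A"
    and "\<And>r p. \<lbrakk>r < length (ws k); coord (f r) p \<noteq> 0\<rbrakk> \<Longrightarrow> path_end Q p = word_start B i (ws k ! r)"
  shows "(\<lambda>r\<in>{..<length (ws k)}. f r) \<in> carrier (C k)"
proof -
  have "(\<lambda>r\<in>{..<length (map (word_start B i) (ws k))}. f r) \<in> carrier (C k)"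
    unfolding koszul_term_def
  proof (rule sum_memI[OF starts_vertices])
    fix r
    assume "r < length (map (word_start B i) (ws k))"
    then have r: "r < length (ws k)"
      by simp
    then show "f r \<in> carrier A"
      by (rule assms(1))
    show "path_end Q p = map (word_start B i) (ws k) ! r" if "coord (f r) p \<noteq> 0" for p
      using assms(2)[OF r that] r by simp
  qed
  then show ?thesis
    by (simp only: length_map)
qed

lemma term_eqI:
  assumes "x \<in> carrier (C k)" "y \<in> carrier (C k)"
    and "\<And>r p. r < length (ws k) \<Longrightarrow> coord (x r) p = coord (y r) p"
  shows "x = y"
proof (rule sum_eqI[OF starts_vertices[of k]])
  show "x \<in> carrier (projective_sum k (map (word_start B i) (ws k)))"
    "y \<in> carrier (projective_sum k (map (word_start B i) (ws k)))"
    using assms(1,2) by (simp_all only: koszul_term_def)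
  fix r p
  assume "r < length (map (word_start B i) (ws k))"
  then have "r < length (ws k)"
    by simp
  then show "coord (x r) p = coord (y r) p"
    by (rule assms(3))
qed

lemma term_component_iff:
  "x \<in> component (C k) m \<longleftrightarrow> x \<in> carrier (C k) \<and>
    (\<forall>r<length (ws k). \<forall>p. coord (x r) p \<noteq> 0 \<longrightarrow> int (path_length p) + int k = m)"
  using sum_component_iff[OF starts_vertices[of k], of x k m] unfolding koszul_term_def length_map .

lemma term_ops:
  "\<zero>\<^bsub>C k\<^esub> = (\<lambda>r\<in>{..<length (ws k)}. \<zero>\<^bsub>A\<^esub>)"
  "x \<oplus>\<^bsub>C k\<^esub> y = (\<lambda>r\<in>{..<length (ws k)}. x r \<oplus>\<^bsub>A\<^esub> y r)"
  "a \<odot>\<^bsub>C k\<^esub> x = (\<lambda>r\<in>{..<length (ws k)}. a \<otimes>\<^bsub>A\<^esub> x r)"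
  by (simp_all only: koszul_term_def sum_ops length_map)

lemma term_graded: "graded_left_module A (bip_component B) (C k)"
  unfolding koszul_term_def by (rule sum_graded[OF starts_vertices])

lemma summand_closed:
  assumes "x \<in> carrier (C (Suc k))" "s < length (ws k)"
  shows "(\<lambda>r. x r \<otimes>\<^bsub>A\<^esub> arrow_class B (hd (ws (Suc k) ! r))) \<in> extensions B i k s \<rightarrow> carrier A"
proof
  fix r
  assume r: "r \<in> extensions B i k s"
  then have "r < length (ws (Suc k))"
    by (simp add: extensions_def)
  then show "x r \<otimes>\<^bsub>A\<^esub> arrow_class B (hd (ws (Suc k) ! r)) \<in> carrier A"
    using term_memD(1)[OF assms(1)] arrow_closed extension_hd(2)[OF assms(2) r] by simp
qed

lemma diff_entry_closed:
  "\<lbrakk>x \<in> carrier (C (Suc k)); s < length (ws k)\<rbrakk> \<Longrightarrow> d k x s \<in> carrier A"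
  by (simp add: koszul_diff_def A.finsum_closed summand_closed)

lemma coord_diff_sum:
  assumes "x \<in> carrier (C (Suc k))" "s < length (ws k)"
  shows "coord (d k x s) p =
    (\<Sum>r\<in>extensions B i k s. coord (x r \<otimes>\<^bsub>A\<^esub> arrow_class B (hd (ws (Suc k) ! r))) p)"
proof -
  have "d k x s = (\<Oplus>\<^bsub>A\<^esub>r\<in>extensions B i k s. x r \<otimes>\<^bsub>A\<^esub> arrow_class B (hd (ws (Suc k) ! r)))"
    using assms(2) by (simp add: koszul_diff_def)
  then show ?thesis
    using coord_sum[OF finite_extensions summand_closed[OF assms], of p] by (simp only:)
qed

section \<open>Coordinates of the differential\<close>

lemma coord_diff_Nil:
  assumes "x \<in> carrier (C (Suc k))" "s < length (ws k)"
  shows "coord (d k x s) (u, []) = 0"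
  unfolding coord_diff_sum[OF assms]
proof (rule sum.neutral, rule ballI)
  fix r
  assume r: "r \<in> extensions B i k s"
  then have "x r \<in> carrier A"
    using term_memD(1)[OF assms(1)] by (simp add: extensions_def)
  then show "coord (x r \<otimes>\<^bsub>A\<^esub> arrow_class B (hd (ws (Suc k) ! r))) (u, []) = 0"
    using extension_hd(2)[OF assms(2) r] by (rule coord_mult_arrow(1))
qed

text \<open>
  Different words that extend the same word \<open>w\<close> have different first arrows, so only the summand of
  \<open>a # w\<close> contributes to the coordinate at a path with last arrow \<open>a\<close>.
\<close>
lemma coord_diff_snoc:
  assumes x: "x \<in> carrier (C (Suc k))" and s: "s < length (ws k)"
    and t: "t < length (ws (Suc k))" "ws (Suc k) ! t = a # ws k ! s"
    and red: "reduced returns_to_part0 (u, p @ [a])"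
  shows "coord (d k x s) (u, p @ [a]) = coord (x t) (u, p)"
proof -
  have tx: "t \<in> extensions B i k s"
    using t by (simp add: extensions_def)
  have summand: "coord (x r \<otimes>\<^bsub>A\<^esub> arrow_class B (hd (ws (Suc k) ! r))) (u, p @ [a]) =
      (if r = t then coord (x t) (u, p) else 0)" if r: "r \<in> extensions B i k s" for r
  proof -
    have rl: "r < length (ws (Suc k))"
      using r by (simp add: extensions_def)
    note xr = term_memD[OF x rl]
    have val: "coord (x r \<otimes>\<^bsub>A\<^esub> arrow_class B (hd (ws (Suc k) ! r))) (u, p @ [a]) =
        (if a = hd (ws (Suc k) ! r) \<and> path_end Q (u, p) = tail Q (hd (ws (Suc k) ! r))
         then coord (x r) (u, p) else 0)"
      by (rule coord_mult_arrow(2)[OF xr(1) extension_hd(2)[OF s r] red])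
    show ?thesis
    proof (cases "r = t")
      case True
      have "path_end Q (u, p) = tail Q a" if "coord (x t) (u, p) \<noteq> 0"
        using term_memD(2)[OF x t(1) that] t(2) by (simp add: word_start_def)
      then show ?thesis
        using True t(2) by (subst val) auto
    next
      case False
      then have "hd (ws (Suc k) ! r) \<noteq> a"
        using extension_hd(1)[OF s r] t rl words_list(2)[of "Suc k"] nth_eq_iff_index_eq by metis
      then show ?thesis
        using False by (subst val) auto
    qed
  qed
  have "coord (d k x s) (u, p @ [a]) =
      (\<Sum>r\<in>extensions B i k s. if r = t then coord (x t) (u, p) else 0)"
    unfolding coord_diff_sum[OF x s] by (rule sum.cong[OF refl]) (rule summand)
  then show ?thesis
    using tx finite_extensions by simp
qed

lemma coord_diff_snoc_0:
  assumes x: "x \<in> carrier (C (Suc k))" and s: "s < length (ws k)"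
    and a: "a # ws k ! s \<notin> W (Suc k)"
  shows "coord (d k x s) (u, p @ [a]) = 0"
proof (cases "reduced returns_to_part0 (u, p @ [a])")
  case True
  show ?thesis
    unfolding coord_diff_sum[OF x s]
  proof (rule sum.neutral, rule ballI)
    fix r
    assume r: "r \<in> extensions B i k s"
    then have rl: "r < length (ws (Suc k))"
      by (simp add: extensions_def)
    have "hd (ws (Suc k) ! r) \<noteq> a"
      using extension_hd(1)[OF s r] a nth_mem[OF rl] words_list(1)[of "Suc k"] by metis
    then show "coord (x r \<otimes>\<^bsub>A\<^esub> arrow_class B (hd (ws (Suc k) ! r))) (u, p @ [a]) = 0"
      using coord_mult_arrow(2)[OF term_memD(1)[OF x rl] extension_hd(2)[OF s r] True] by auto
  qed
qed (simp add: coord_not_reduced)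

lemma diff_nonzeroE:
  assumes "x \<in> carrier (C (Suc k))" "s < length (ws k)" "coord (d k x s) (u, q) \<noteq> 0"
  obtains p a t where "q = p @ [a]" "t < length (ws (Suc k))" "ws (Suc k) ! t = a # ws k ! s"
    "coord (x t) (u, p) \<noteq> 0" "reduced returns_to_part0 (u, p @ [a])"
proof -
  obtain p a where q: "q = p @ [a]"
    using assms coord_diff_Nil by (cases q rule: rev_cases) auto
  have "a # ws k ! s \<in> W (Suc k)"
    using assms coord_diff_snoc_0 q by blast
  then obtain t where t: "t < length (ws (Suc k))" "ws (Suc k) ! t = a # ws k ! s"
    using words_list(1)[of "Suc k"] by (metis in_set_conv_nth)
  have red: "reduced returns_to_part0 (u, p @ [a])"
    using assms(3) q coord_not_reduced by metis
  show thesis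
    using that[OF q t _ red] assms coord_diff_snoc[OF assms(1,2) t red] q by simp
qed

lemma diff_closed:
  assumes "x \<in> carrier (C (Suc k))"
  shows "d k x \<in> carrier (C k)"
proof -
  have "(\<lambda>s\<in>{..<length (ws k)}. d k x s) \<in> carrier (C k)"
  proof (rule term_memI)
    fix s p
    assume s: "s < length (ws k)" and p: "coord (d k x s) p \<noteq> 0"
    obtain u q where uq: "p = (u, q)"
      by fastforce
    then obtain p' a t where q: "q = p' @ [a]"
      and t: "t < length (ws (Suc k))" "ws (Suc k) ! t = a # ws k ! s"
      using diff_nonzeroE[OF assms s] p by metis
    have "t \<in> extensions B i k s"
      using t by (simp add: extensions_def)
    from extension_hd(3)[OF s this] show "path_end Q p = word_start B i (ws k ! s)"
      using q t uq by simp
  qed (rule diff_entry_closed[OF assms])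
  moreover have "(\<lambda>s\<in>{..<length (ws k)}. d k x s) = d k x"
    unfolding koszul_diff_def by (rule restrict_ext) (rule restrict_apply')
  ultimately show ?thesis
    by (simp only:)
qed

lemma diff_hom: "d k \<in> graded_hom A (C (Suc k)) (C k)"
proof -
  have arrow: "arrow_class B (hd (ws (Suc k) ! r)) \<in> carrier A"
    if "s < length (ws k)" "r \<in> extensions B i k s" for r s
    using extension_hd(2)[OF that] by (rule arrow_closed)
  have ext: "r < length (ws (Suc k))" if "r \<in> extensions B i k s" for r s
    using that by (simp add: extensions_def)
  have "d k (x \<oplus>\<^bsub>C (Suc k)\<^esub> y) = d k x \<oplus>\<^bsub>C k\<^esub> d k y"
    if x: "x \<in> carrier (C (Suc k))" and y: "y \<in> carrier (C (Suc k))" for x y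
    unfolding term_ops koszul_diff_def
  proof (rule restrict_ext)
    fix s
    assume "s \<in> {..<length (ws k)}"
    then have s: "s < length (ws k)"
      by simp
    let ?g = "\<lambda>x r. x r \<otimes>\<^bsub>A\<^esub> arrow_class B (hd (ws (Suc k) ! r))"
    have "(\<Oplus>\<^bsub>A\<^esub>r\<in>extensions B i k s. ?g (\<lambda>r\<in>{..<length (ws (Suc k))}. x r \<oplus>\<^bsub>A\<^esub> y r) r) =
        (\<Oplus>\<^bsub>A\<^esub>r\<in>extensions B i k s. ?g x r \<oplus>\<^bsub>A\<^esub> ?g y r)"
      using summand_closed[OF x s] summand_closed[OF y s]
      by (intro A.finsum_cong')
        (auto simp: A.l_distr arrow[OF s] ext term_memD(1)[OF x] term_memD(1)[OF y])
    then show "(\<Oplus>\<^bsub>A\<^esub>r\<in>extensions B i k s. ?g (\<lambda>r\<in>{..<length (ws (Suc k))}. x r \<oplus>\<^bsub>A\<^esub> y r) r) =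
        (\<lambda>s\<in>{..<length (ws k)}. \<Oplus>\<^bsub>A\<^esub>r\<in>extensions B i k s. ?g x r) s \<oplus>\<^bsub>A\<^esub>
        (\<lambda>s\<in>{..<length (ws k)}. \<Oplus>\<^bsub>A\<^esub>r\<in>extensions B i k s. ?g y r) s"
      using s A.finsum_addf[OF summand_closed[OF x s] summand_closed[OF y s]] by simp
  qed
  moreover have "d k (a \<odot>\<^bsub>C (Suc k)\<^esub> x) = a \<odot>\<^bsub>C k\<^esub> d k x"
    if a: "a \<in> carrier A" and x: "x \<in> carrier (C (Suc k))" for a x
    unfolding term_ops koszul_diff_def
  proof (rule restrict_ext)
    fix s
    assume "s \<in> {..<length (ws k)}"
    then have s: "s < length (ws k)"
      by simp
    let ?g = "\<lambda>x r. x r \<otimes>\<^bsub>A\<^esub> arrow_class B (hd (ws (Suc k) ! r))"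
    have "(\<Oplus>\<^bsub>A\<^esub>r\<in>extensions B i k s. ?g (\<lambda>r\<in>{..<length (ws (Suc k))}. a \<otimes>\<^bsub>A\<^esub> x r) r) =
        (\<Oplus>\<^bsub>A\<^esub>r\<in>extensions B i k s. a \<otimes>\<^bsub>A\<^esub> ?g x r)"
      using summand_closed[OF x s] a
      by (intro A.finsum_cong') (auto simp: A.m_assoc arrow[OF s] ext term_memD(1)[OF x])
    then show "(\<Oplus>\<^bsub>A\<^esub>r\<in>extensions B i k s. ?g (\<lambda>r\<in>{..<length (ws (Suc k))}. a \<otimes>\<^bsub>A\<^esub> x r) r) =
        a \<otimes>\<^bsub>A\<^esub> (\<lambda>s\<in>{..<length (ws k)}. \<Oplus>\<^bsub>A\<^esub>r\<in>extensions B i k s. ?g x r) s"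
      using s A.finsum_rdistr[OF finite_extensions a summand_closed[OF x s]] by simp
  qed
  moreover have "d k x \<in> component (C k) m" if "x \<in> component (C (Suc k)) m" for x m
  proof -
    have x: "x \<in> carrier (C (Suc k))"
      and deg: "\<And>r p. \<lbrakk>r < length (ws (Suc k)); coord (x r) p \<noteq> 0\<rbrakk> \<Longrightarrow> int (path_length p) + int (Suc k) = m"
      using that by (auto simp: term_component_iff)
    have "int (path_length (u, q)) + int k = m"
      if s: "s < length (ws k)" and nz: "coord (d k x s) (u, q) \<noteq> 0" for s u q
    proof -
      obtain p a t where "q = p @ [a]" "t < length (ws (Suc k))" "coord (x t) (u, p) \<noteq> 0"
        using diff_nonzeroE[OF x s nz] by metis
      then show ?thesis
        using deg[of t "(u, p)"] by (simp add: path_length_def)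
    qed
    then show ?thesis
      using diff_closed[OF x] by (auto simp: term_component_iff)
  qed
  ultimately show ?thesis
    by (simp add: graded_hom_def diff_closed)
qed

section \<open>Exactness\<close>

text \<open>
  The coefficients required of a preimage under the differential are realized by an element of the
  algebra: initial segments of reduced paths are reduced.
\<close>
lemma ex_strip_arrow:
  assumes "b \<in> carrier A"
  shows "\<exists>c\<in>carrier A. \<forall>u p. coord c (u, p) = coord b (u, p @ [a])"
proof -
  define f where "f = (\<lambda>(u, p). coord b (u, p @ [a]))"
  have "{x. f x \<noteq> 0} \<subseteq> (\<lambda>(u, p). (u, butlast p)) ` {x. coord b x \<noteq> 0}"
  proof clarify
    fix u p
    assume "f (u, p) \<noteq> 0"
    then show "(u, p) \<in> (\<lambda>(u, p). (u, butlast p)) ` {x. coord b x \<noteq> 0}"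
      by (intro image_eqI[of _ _ "(u, p @ [a])"]) (auto simp: f_def)
  qed
  moreover have "finite {x. coord b x \<noteq> 0}"
    using coord_closed[OF assms] path_carrier_iff by blast
  ultimately have "finite {x. f x \<noteq> 0}"
    using finite_surj by blast
  moreover have fD: "(u, p) \<in> paths Q \<and> reduced returns_to_part0 (u, p)" if "f (u, p) \<noteq> 0" for u p
    using coord_nonzeroD[OF assms, of "(u, p @ [a])"] that
    by (auto simp: f_def Q.paths_append dest: reduced_appendD)
  ultimately have f: "f \<in> carrier PA"
    by (auto simp: path_carrier_iff)
  have "coord (bip_class B f) (u, p) = coord b (u, p @ [a])" for u p
    using fD[of u p] unfolding coord_class[OF f] by (auto simp: f_def)
  then show ?thesis
    using class_closed[OF f] by blast
qed

text \<open>
  The basis elements that occur in \<open>y\<close> have the form \<open>(p @ [a], w)\<close>, where \<open>a # w\<close> is again a word.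
  This condition describes both the image of one differential and the kernel of the next.
\<close>
definition movable :: "nat \<Rightarrow> (nat \<Rightarrow> ('v, 'e) bip) \<Rightarrow> bool" where
  "movable k y \<longleftrightarrow> (\<forall>s<length (ws k). (\<forall>u. coord (y s) (u, []) = 0) \<and>
     (\<forall>u p a. a # ws k ! s \<notin> W (Suc k) \<longrightarrow> coord (y s) (u, p @ [a]) = 0))"

lemma movableD:
  assumes "movable k y" "s < length (ws k)"
  shows "coord (y s) (u, []) = 0"
    and "a # ws k ! s \<notin> W (Suc k) \<Longrightarrow> coord (y s) (u, p @ [a]) = 0"
  using assms unfolding movable_def by blast+

text \<open>
  A preimage is found by undoing the move of an arrow: the coefficient of \<open>(p, a # w)\<close> in it is the
  coefficient of \<open>(p @ [a], w)\<close> in \<open>y\<close>.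
\<close>
lemma diff_image: "d k ` carrier (C (Suc k)) = {y \<in> carrier (C k). movable k y}"
proof (intro equalityI subsetI)
  fix y
  assume "y \<in> d k ` carrier (C (Suc k))"
  then show "y \<in> {y \<in> carrier (C k). movable k y}"
    by (auto simp: movable_def diff_closed coord_diff_Nil coord_diff_snoc_0)
next
  fix y
  assume "y \<in> {y \<in> carrier (C k). movable k y}"
  then have y: "y \<in> carrier (C k)" and div: "movable k y"
    by auto
  \<comment> \<open>The word at \<open>r\<close> determines \<open>a\<close> and \<open>s\<close>, so there is just one requirement on \<open>b\<close>.\<close>
  have "\<exists>b\<in>carrier A. \<forall>s a. s < length (ws k) \<and> ws (Suc k) ! r = a # ws k ! s \<longrightarrow>
      (\<forall>u p. coord b (u, p) = coord (y s) (u, p @ [a]))" if r: "r < length (ws (Suc k))" for r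
  proof -
    have "ws (Suc k) ! r \<in> W (Suc k)"
      using nth_mem[OF r] words_list by simp
    then obtain a q where w: "ws (Suc k) ! r = a # q" "q \<in> W k"
      by (rule words_Suc_cases)
    then obtain s where s: "s < length (ws k)" "ws k ! s = q"
      using words_list(1)[of k] by (metis in_set_conv_nth)
    obtain b where b: "b \<in> carrier A" "\<And>u p. coord b (u, p) = coord (y s) (u, p @ [a])"
      using ex_strip_arrow[OF term_memD(1)[OF y s(1)]] by metis
    have "s' = s \<and> a' = a" if "s' < length (ws k)" "ws (Suc k) ! r = a' # ws k ! s'" for s' a'
      using that w s words_list(2)[of k] nth_eq_iff_index_eq by (metis list.inject)
    then show ?thesis
      using b by blast
  qed
  then obtain x where xA: "\<And>r. r < length (ws (Suc k)) \<Longrightarrow> x r \<in> carrier A"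
    and x: "\<And>r s a u p. \<lbrakk>r < length (ws (Suc k)); s < length (ws k); ws (Suc k) ! r = a # ws k ! s\<rbrakk> \<Longrightarrow>
      coord (x r) (u, p) = coord (y s) (u, p @ [a])"
    by metis
  let ?x = "\<lambda>r\<in>{..<length (ws (Suc k))}. x r"
  have xC: "?x \<in> carrier (C (Suc k))"
  proof (rule term_memI[OF xA])
    fix r p
    assume r: "r < length (ws (Suc k))" and nz: "coord (x r) p \<noteq> 0"
    obtain u q where p: "p = (u, q)"
      by fastforce
    have "ws (Suc k) ! r \<in> W (Suc k)"
      using nth_mem[OF r] words_list by simp
    then obtain a v where w: "ws (Suc k) ! r = a # v" "v \<in> W k"
      by (rule words_Suc_cases)
    then obtain s where s: "s < length (ws k)" "ws k ! s = v"
      using words_list(1)[of k] by (metis in_set_conv_nth)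
    have "coord (y s) (u, q @ [a]) \<noteq> 0"
      using x[OF r s(1)] w s nz p by simp
    then have "(u, q @ [a]) \<in> paths Q"
      using coord_nonzeroD term_memD(1)[OF y s(1)] by blast
    then show "path_end Q p = word_start B i (ws (Suc k) ! r)"
      using w p by (simp add: Q.paths_append Q.paths_Cons word_start_def)
  qed
  have "d k ?x = y"
  proof (rule term_eqI[OF diff_closed[OF xC] y])
    fix s and p :: "('v, 'e \<times> bool) path"
    assume s: "s < length (ws k)"
    obtain u q where p: "p = (u, q)"
      by fastforce
    show "coord (d k ?x s) p = coord (y s) p"
    proof (cases q rule: rev_cases)
      case Nil
      then show ?thesis
        using movableD(1)[OF div s] by (simp add: p Nil coord_diff_Nil[OF xC s])
    next
      case (snoc q' a)
      consider "\<not> reduced returns_to_part0 (u, q)" | "a # ws k ! s \<notin> W (Suc k)"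
        | "reduced returns_to_part0 (u, q)" "a # ws k ! s \<in> W (Suc k)"
        by blast
      then show ?thesis
      proof cases
        case 1
        then show ?thesis
          by (simp add: p coord_not_reduced)
      next
        case 2
        then show ?thesis
          using movableD(2)[OF div s 2] by (simp add: p snoc coord_diff_snoc_0[OF xC s 2])
      next
        case 3
        then obtain t where t: "t < length (ws (Suc k))" "ws (Suc k) ! t = a # ws k ! s"
          using words_list(1)[of "Suc k"] by (metis in_set_conv_nth)
        then show ?thesis
          using coord_diff_snoc[OF xC s t, of u q'] x[OF t(1) s t(2)] 3 by (simp add: p snoc)
      qed
    qed
  qed
  then show "y \<in> d k ` carrier (C (Suc k))"
    using xC by blast
qed

lemma diff_zero_iff:
  assumes x: "x \<in> carrier (C (Suc k))"
  shows "d k x = \<zero>\<^bsub>C k\<^esub> \<longleftrightarrow> (\<forall>s<length (ws k). \<forall>p. coord (d k x s) p = 0)"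
proof
  assume "d k x = \<zero>\<^bsub>C k\<^esub>"
  then show "\<forall>s<length (ws k). \<forall>p. coord (d k x s) p = 0"
    by (simp add: term_ops)
next
  assume "\<forall>s<length (ws k). \<forall>p. coord (d k x s) p = 0"
  then show "d k x = \<zero>\<^bsub>C k\<^esub>"
    using term_memI[of k "\<lambda>_. \<zero>\<^bsub>A\<^esub>"]
    by (intro term_eqI[OF diff_closed[OF x]]) (auto simp: term_ops)
qed

text \<open>
  A word of length \<open>k + 1\<close> has the form \<open>a # w\<close>. The differential \<open>d k\<close> sends \<open>([], a # w)\<close> to the nonzero
  element \<open>([a], w)\<close>. It sends \<open>(p @ [b], a # w)\<close> to \<open>0\<close> if \<open>b\<close> and \<open>a\<close> form a relation, that is, if
  \<open>b # a # w\<close> is a word; otherwise \<open>p @ [b, a]\<close> is reduced because relations have length two, and the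
  image is a basis element. Different basis elements that survive have different images, so the
  coefficients can be inspected one at a time.
\<close>
lemma diff_kernel:
  assumes y: "y \<in> carrier (C (Suc k))"
  shows "d k y = \<zero>\<^bsub>C k\<^esub> \<longleftrightarrow> movable (Suc k) y"
proof
  assume "d k y = \<zero>\<^bsub>C k\<^esub>"
  then have zero: "coord (d k y s) p = 0" if "s < length (ws k)" for s p
    using that diff_zero_iff[OF y] by blast
  show "movable (Suc k) y"
    unfolding movable_def
  proof (intro allI impI conjI)
    fix t
    assume t: "t < length (ws (Suc k))"
    then have "ws (Suc k) ! t \<in> W (Suc k)"
      using nth_mem[OF t] words_list by simp
    then obtain a q where w: "ws (Suc k) ! t = a # q" "q \<in> W k"
      by (rule words_Suc_cases)
    then obtain s where s: "s < length (ws k)" "ws k ! s = q"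
      using words_list(1)[of k] by (metis in_set_conv_nth)
    have w': "ws (Suc k) ! t = a # ws k ! s"
      using w s by simp
    fix u
    show "coord (y t) (u, []) = 0"
      using coord_diff_snoc[OF y s(1) t w', of u "[]"] zero[OF s(1)] by simp
    fix p b
    assume b: "b # ws (Suc k) ! t \<notin> W (Suc (Suc k))"
    show "coord (y t) (u, p @ [b]) = 0"
    proof (rule ccontr)
      assume nz: "coord (y t) (u, p @ [b]) \<noteq> 0"
      have red: "reduced returns_to_part0 (u, p @ [b])" and "(u, p @ [b]) \<in> paths Q"
        using coord_nonzeroD[OF term_memD(1)[OF y t] nz] .
      then have "b \<in> arcs Q"
        by (simp add: Q.paths_append Q.paths_Cons)
      moreover have "head Q b = word_start B i (ws (Suc k) ! t)"
        using term_memD(2)[OF y t nz] by simp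
      ultimately have "\<not> returns_to_part0 b a"
        using b \<open>ws (Suc k) ! t \<in> W (Suc k)\<close> Cons_word_iff[of b "ws (Suc k) ! t" "Suc k"] by (simp add: w(1))
      then have "reduced returns_to_part0 (u, (p @ [b]) @ [a])"
        using red reduced_snoc2[of returns_to_part0 u p b a] by simp
      from coord_diff_snoc[OF y s(1) t w' this] show False
        using zero[OF s(1)] nz by simp
    qed
  qed
next
  assume div: "movable (Suc k) y"
  have "coord (d k y s) (u, q) = 0" if s: "s < length (ws k)" for s u q
  proof (rule ccontr)
    assume "coord (d k y s) (u, q) \<noteq> 0"
    then obtain p a t where q: "q = p @ [a]" and t: "t < length (ws (Suc k))" "ws (Suc k) ! t = a # ws k ! s"
      and nz: "coord (y t) (u, p) \<noteq> 0" and red: "reduced returns_to_part0 (u, p @ [a])"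
      by (rule diff_nonzeroE[OF y s])
    have "p \<noteq> []"
      using nz movableD(1)[OF div t(1)] by auto
    then obtain p' b where p: "p = p' @ [b]"
      by (cases p rule: rev_cases) auto
    then have "b # a # ws k ! s \<in> W (Suc (Suc k))"
      using movableD(2)[OF div t(1), of b u p'] t(2) nz by auto
    then have "returns_to_part0 b a"
      by (simp add: Cons_word_iff)
    then show False
      using red reduced_snoc2[of returns_to_part0 u p' b a] by (simp add: p)
  qed
  then show "d k y = \<zero>\<^bsub>C k\<^esub>"
    using diff_zero_iff[OF y] by auto
qed

lemma list_0: "ws 0 = [[]]"
proof -
  have "length (ws 0) = 1"
    using words_list[of 0] distinct_card[of "ws 0"] by (simp add: words_0)
  then obtain w where "ws 0 = [w]"
    by (metis One_nat_def length_0_conv length_Suc_conv)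
  then show ?thesis
    using words_list(1)[of 0] by (simp add: words_0)
qed

text \<open>
  In degree \<open>0\<close> the only word is empty and every arrow into \<open>i\<close> extends it to a word, so the condition
  only excludes the constant path at \<open>i\<close>.
\<close>
lemma augmentation_kernel:
  assumes y: "y \<in> carrier (C 0)"
  shows "augmentation i y = 0 \<longleftrightarrow> movable 0 y"
proof
  note y0 = term_memD[OF y, of 0, unfolded list_0, simplified]
  assume aug: "augmentation i y = 0"
  have "coord (y 0) (u, []) = 0" for u
  proof (cases "u = i")
    case False
    then show ?thesis
      using y0(2)[of "(u, [])"] by (auto simp: word_start_def)
  qed (use aug in \<open>simp add: augmentation_def\<close>)
  moreover have "coord (y 0) (u, p @ [a]) = 0" if "[a] \<notin> W (Suc 0)" for u p a
  proof (rule ccontr)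
    assume nz: "coord (y 0) (u, p @ [a]) \<noteq> 0"
    have "a \<in> arcs Q"
      using coord_nonzeroD(2)[OF y0(1) nz] by (simp add: Q.paths_append Q.paths_Cons)
    moreover have "head Q a = i"
      using y0(2)[OF nz] by (simp add: word_start_def)
    ultimately show False
      using that by (simp add: Cons_word_iff words_0 word_start_def)
  qed
  ultimately show "movable 0 y"
    by (simp add: movable_def list_0)
qed (simp add: movable_def list_0 augmentation_def)

lemma augmentation_hom: "augmentation i \<in> graded_hom A (C 0) (bip_simple B i)"
proof -
  have y0: "y 0 \<in> carrier A" if "y \<in> carrier (C 0)" for y
    using term_memD(1)[OF that, of 0] by (simp add: list_0)
  have "augmentation i x = 0" if "x \<in> component (C 0) m" "m \<noteq> 0" for x m
    using that by (fastforce simp: term_component_iff list_0 augmentation_def path_length_def)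
  then show ?thesis
    unfolding graded_hom_def mem_Collect_eq
    by (intro conjI ballI allI)
      (simp_all add: simple_ops term_ops list_0 augmentation_def y0 coord_add coord_mult_Nil)
qed

lemma augmentation_surj: "augmentation i ` carrier (C 0) = UNIV"
proof -
  have "c \<in> augmentation i ` carrier (C 0)" for c
  proof -
    let ?f = "\<lambda>y. c * path_vector (i, []) y"
    have f: "?f \<in> carrier PA"
      using vertex by (intro path_vector_scaled_closed) (simp add: Q.paths_Nil)
    have "(\<lambda>r\<in>{..<length (ws 0)}. bip_class B ?f) \<in> carrier (C 0)"
      by (rule term_memI)
        (simp_all add: class_closed[OF f] coord_class[OF f] list_0 word_start_def,
          auto simp: path_vector_def split: if_splits)
    moreover have "augmentation i (\<lambda>r\<in>{..<length (ws 0)}. bip_class B ?f) = c"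
      by (simp add: augmentation_def list_0 coord_class[OF f]) (simp add: path_vector_def)
    ultimately show ?thesis
      by (intro image_eqI[of c]) (simp_all only:)
  qed
  then show ?thesis
    by blast
qed

lemma koszul_resolution: "linear_projective_resolution B (bip_simple B i) C d (augmentation i)"
proof -
  have "\<exists>js. set js \<subseteq> vertices B \<and>
      C k = graded_direct_sum (map (\<lambda>j. grading_shift (int k) (bip_projective B j)) js)" for k
    by (intro exI[of _ "map (word_start B i) (ws k)"] conjI starts_vertices koszul_term_def)
  moreover have "d 0 ` carrier (C 1) = a_kernel (C 0) (bip_simple B i) (augmentation i)"
    using diff_image[of 0]
    by (simp add: a_kernel_def' simple_ops augmentation_kernel cong: conj_cong)
  moreover have "d (Suc k) ` carrier (C (Suc (Suc k))) = a_kernel (C (Suc k)) (C k) (d k)" for k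
    by (simp add: diff_image a_kernel_def' diff_kernel cong: conj_cong)
  ultimately show ?thesis
    unfolding linear_projective_resolution_def Let_def
    using simple_graded[OF vertex] term_graded augmentation_hom diff_hom augmentation_surj
    by (simp add: simple_ops)
qed

text \<open>
  After \<open>part0\<close>, \<open>part1\<close>, \<open>part0\<close> a path continues to \<open>part1\<close>, so two overlapping pairs of arrows are
  never both relations and no word has three arrows.
\<close>
lemma koszul_finite: "finite_complex C"
proof -
  have "carrier (C k) = {\<zero>\<^bsub>C k\<^esub>}" if k: "k > 2" for k
  proof -
    have "W k = {}"
    proof -
      have "\<not> successively returns_to_part0 q" if q: "length q > 2" for q :: "('e \<times> bool) list"
      proof -
        obtain a b c q' where "q = a # b # c # q'"
          using q by (auto simp: numeral_2_eq_2 Suc_le_eq[symmetric] Suc_le_length_iff)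
        then show ?thesis
          by (auto simp: returns_to_part0_def)
      qed
      then show ?thesis
        using k by (auto simp: koszul_words_def)
    qed
    then have "ws k = []"
      using words_list(1)[of k] by simp
    then show ?thesis
      by (simp add: koszul_term_def graded_direct_sum_def restrict_def)
  qed
  then show ?thesis
    unfolding finite_complex_def by blast
qed

end

theorem proposition2p4:
  fixes B :: "('v, 'e) bipartite_graph" and i :: 'v
  assumes "finite_bipartite_graph B" and "i \<in> vertices B"
  shows "\<exists>C d \<epsilon>. linear_projective_resolution B (bip_simple B i) C d \<epsilon> \<and> finite_complex C"
proof -
  interpret bipartite_vertex B i
    using assms by unfold_locales
  show ?thesis
    using koszul_resolution koszul_finite by blast
qed

end
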